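(* Let $q>0$, $\kappa>0$, and let $(\phi,A,N)$ be any admissible topological solution (as defined in the context) of the Bogomol'nyi equations $$A_0=-N,\qquad (D_1+iD_2)\phi=0,\qquad F_{12}+(q|\phi|^2+\kappa N-q)=0,$$ $$\Delta A_0=\kappa q(1-|\phi|^2)+\kappa^2A_0+2q^2|\phi|^2A_0$$ on $\mathbf{R}^2$. Set $\rho=\kappa/q$ and $\gamma=\frac{-\rho^2+\rho\sqrt{\rho^2+8}}{4}$ (so that $0<\gamma<1$). Then for every $\epsilon$ with $0<\epsilon<1-\gamma$ there exist $r_0=r_0(\epsilon)>0$ and $C_\epsilon>0$ such that for all $z\in\mathbf{R}^2$ with $|z|>r_0$: $$0\le 1-|\phi(z)|^2\le C_\epsilon e^{-q(1-\gamma-\epsilon)^{1/2}|z|},\qquad |N(z)|,\ |F_{12}(z)|\le C_\epsilon e^{-q(1-\gamma-\epsilon)^{1/2}|z|},$$ $$|D_\mu\phi(z)|\ (\mu=0,1,2),\ |\nabla A_0(z)|\le C_\epsilon e^{-q(1-\gamma-\epsilon)^{1/2}|z|}.$$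
   Context: The unknowns are smooth static fields on $\mathbf{R}^2$: a complex-valued function $\phi$, a real-valued function $N$, and real-valued functions $A=(A_0,A_1,A_2)$. Notation: $\partial_j=\partial/\partial x_j$ for $j=1,2$, $\partial_0=\partial/\partial t$ (which acts as zero on static fields), $D_\mu=\partial_\mu-iqA_\mu$ for $\mu=0,1,2$ (so $D_0\phi=-iqA_0\phi$), $F_{12}=\partial_1A_2-\partial_2A_1$. Let $z_1,\dots,z_m\in\mathbf{R}^2$ be distinct points and $n_1,\dots,n_m$ positive integers; $\phi$ vanishes exactly at the points $z_j$, with winding number $n_j$ at $z_j$ (the degree of $\phi/|\phi|$ on small circles around $z_j$), and $$u=\ln|\phi|^2=v+f,\qquad f(z)=\sum_{j=1}^m n_j\ln\left(\frac{|z-z_j|^2}{1+|z-z_j|^2}\right),$$ with $v$ smooth on $\mathbf{R}^2$. In terms of $(v,A_0)$ the equations read $$\Delta v=2q^2(e^{v+f}-1)-2q\kappa A_0+g,\qquad \Delta A_0=\kappa q(1-e^{v+f})+(\kappa^2+2q^2e^{v+f})A_0,$$ where $g(z)=\sum_{j=1}^m\frac{4n_j}{(1+|z-z_j|^2)^2}$. The solution is topological if $|\phi|^2\to1$ and $N=-A_0\to0$ as $|z|\to\infty$, i.e. $v\to0$ and $A_0\to0$. A topological solution is called admissible if any one of the following four (mutually equivalent) conditions holds on $\mathbf{R}^2$: (i) $A_0\le0$; (ii) $v\le-f$; (iii) $A_0\ge\frac q\kappa(e^{v+f}-1)$; (iv) $v\le v_a^q$, where $v_a^q\in H^2(\mathbf{R}^2)\cap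 C^\infty(\mathbf{R}^2)$ is the unique solution of $\Delta v_a^q=2q^2(e^{v_a^q+f}-1)+g$ (the finite energy Abelian Higgs solution). *)

theory Defs
  imports "HOL-Analysis.Analysis" "HOL-Complex_Analysis.Winding_Numbers"
begin

section \<open>Calculus on the plane\<close>

definition pd :: "2 \<Rightarrow> (real ^ 2 \<Rightarrow> 'a::real_normed_vector) \<Rightarrow> real ^ 2 \<Rightarrow> 'a" where
  "pd j f x = frechet_derivative f (at x) (axis j 1)"

text \<open>The total derivative of every iterated partial derivative exists, so all of them are
  continuous and the function is \<open>C\<close>-infinity.\<close>

definition smooth :: "(real ^ 2 \<Rightarrow> 'a::real_normed_vector) \<Rightarrow> bool" where
  "smooth f \<longleftrightarrow> (\<forall>js. foldr pd js f differentiable_on UNIV)"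

definition laplacian :: "(real ^ 2 \<Rightarrow> real) \<Rightarrow> real ^ 2 \<Rightarrow> real" where
  "laplacian f x = (\<Sum>j\<in>UNIV. pd j (pd j f) x)"

definition grad :: "(real ^ 2 \<Rightarrow> real) \<Rightarrow> real ^ 2 \<Rightarrow> real ^ 2" where
  "grad f x = (\<chi> j. pd j f x)"

text \<open>Membership in the intersection of \<open>H\<^sup>2\<close> with the smooth functions. The weak derivatives of a
  smooth function are its classical ones, so no theory of distributions is needed.\<close>

definition smooth_H2 :: "(real ^ 2 \<Rightarrow> real) \<Rightarrow> bool" where
  "smooth_H2 f \<longleftrightarrow> smooth f \<and>
     (\<forall>js. length js \<le> 2 \<longrightarrow> integrable lborel (\<lambda>x. (foldr pd js f x)\<^sup>2))"

section \<open>Gauge fields\<close>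

text \<open>Fields are static, so the time derivative (index 0) acts as zero. Only the components
  \<open>A 0\<close>, \<open>A 1\<close>, \<open>A 2\<close> of a potential are ever used.\<close>

definition spacetime_pd :: "nat \<Rightarrow> (real ^ 2 \<Rightarrow> complex) \<Rightarrow> real ^ 2 \<Rightarrow> complex" where
  "spacetime_pd \<mu> f x = (if \<mu> = 1 then pd 1 f x else if \<mu> = 2 then pd 2 f x else 0)"

definition cov_deriv ::
  "real \<Rightarrow> (nat \<Rightarrow> real ^ 2 \<Rightarrow> real) \<Rightarrow> nat \<Rightarrow> (real ^ 2 \<Rightarrow> complex) \<Rightarrow> real ^ 2 \<Rightarrow> complex" where
  "cov_deriv q A \<mu> \<phi> x = spacetime_pd \<mu> \<phi> x - \<i> * of_real q * of_real (A \<mu> x) * \<phi> x"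

definition F12 :: "(nat \<Rightarrow> real ^ 2 \<Rightarrow> real) \<Rightarrow> real ^ 2 \<Rightarrow> real" where
  "F12 A x = pd 1 (A 2) x - pd 2 (A 1) x"

definition smooth_fields ::
  "(real ^ 2 \<Rightarrow> complex) \<Rightarrow> (nat \<Rightarrow> real ^ 2 \<Rightarrow> real) \<Rightarrow> (real ^ 2 \<Rightarrow> real) \<Rightarrow> bool" where
  "smooth_fields \<phi> A N \<longleftrightarrow> smooth \<phi> \<and> (\<forall>\<mu>\<in>{0, 1, 2}. smooth (A \<mu>)) \<and> smooth N"

definition bogomolnyi ::
  "real \<Rightarrow> real \<Rightarrow> (real ^ 2 \<Rightarrow> complex) \<Rightarrow> (nat \<Rightarrow> real ^ 2 \<Rightarrow> real) \<Rightarrow> (real ^ 2 \<Rightarrow> real) \<Rightarrow> bool" where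
  "bogomolnyi q \<kappa> \<phi> A N \<longleftrightarrow>
     (\<forall>x. A 0 x = - N x) \<and>
     (\<forall>x. cov_deriv q A 1 \<phi> x + \<i> * cov_deriv q A 2 \<phi> x = 0) \<and>
     (\<forall>x. F12 A x + (q * (cmod (\<phi> x))\<^sup>2 + \<kappa> * N x - q) = 0) \<and>
     (\<forall>x. laplacian (A 0) x =
        \<kappa> * q * (1 - (cmod (\<phi> x))\<^sup>2) + \<kappa>\<^sup>2 * A 0 x + 2 * q\<^sup>2 * (cmod (\<phi> x))\<^sup>2 * A 0 x)"

section \<open>Vortices\<close>

text \<open>The points are \<open>z 1, \<dots>, z m\<close> with multiplicities \<open>n 1, \<dots>, n m\<close>. At a vortex
  point the mathematical value of \<open>vortex_f\<close> is minus infinity, whereas the formula below gives a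
  meaningless real number there because \<open>ln 0 = 0\<close>. It is therefore only ever used away from the
  vortex points, and \<open>exp_vf\<close> is the exponential of \<open>v + vortex_f\<close> with the correct value 0 at them.\<close>

definition vortex_f :: "nat \<Rightarrow> (nat \<Rightarrow> real ^ 2) \<Rightarrow> (nat \<Rightarrow> nat) \<Rightarrow> real ^ 2 \<Rightarrow> real" where
  "vortex_f m z n x =
     (\<Sum>j = 1..m. real (n j) * ln ((norm (x - z j))\<^sup>2 / (1 + (norm (x - z j))\<^sup>2)))"

definition vortex_g :: "nat \<Rightarrow> (nat \<Rightarrow> real ^ 2) \<Rightarrow> (nat \<Rightarrow> nat) \<Rightarrow> real ^ 2 \<Rightarrow> real" where
  "vortex_g m z n x = (\<Sum>j = 1..m. 4 * real (n j) / (1 + (norm (x - z j))\<^sup>2)\<^sup>2)"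

definition exp_vf ::
  "nat \<Rightarrow> (nat \<Rightarrow> real ^ 2) \<Rightarrow> (nat \<Rightarrow> nat) \<Rightarrow> (real ^ 2 \<Rightarrow> real) \<Rightarrow> real ^ 2 \<Rightarrow> real" where
  "exp_vf m z n v x = (if x \<in> z ` {1..m} then 0 else exp (v x + vortex_f m z n x))"

text \<open>The degree of \<open>\<phi> / |\<phi>|\<close> on a circle is the winding number about 0 of its restriction to the
  counterclockwise circle; \<open>sgn w = w / |w|\<close> for complex \<open>w\<close>.\<close>

definition has_vortices ::
  "nat \<Rightarrow> (nat \<Rightarrow> real ^ 2) \<Rightarrow> (nat \<Rightarrow> nat) \<Rightarrow> (real ^ 2 \<Rightarrow> complex) \<Rightarrow> (real ^ 2 \<Rightarrow> real) \<Rightarrow> bool" where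
  "has_vortices m z n \<phi> v \<longleftrightarrow>
     inj_on z {1..m} \<and>
     (\<forall>j\<in>{1..m}. n j > 0) \<and>
     {x. \<phi> x = 0} = z ` {1..m} \<and>
     (\<forall>j\<in>{1..m}. \<forall>\<^sub>F r in at_right 0.
        winding_number
          (\<lambda>t. sgn (\<phi> (z j + r *\<^sub>R vector [cos (2 * pi * t), sin (2 * pi * t)]))) 0
        = of_nat (n j)) \<and>
     smooth v \<and>
     (\<forall>x. x \<notin> z ` {1..m} \<longrightarrow> ln ((cmod (\<phi> x))\<^sup>2) = v x + vortex_f m z n x)"

definition topological :: "(real ^ 2 \<Rightarrow> complex) \<Rightarrow> (real ^ 2 \<Rightarrow> real) \<Rightarrow> bool" where
  "topological \<phi> N \<longleftrightarrow>
     ((\<lambda>x. (cmod (\<phi> x))\<^sup>2) \<longlongrightarrow> 1) at_infinity \<and> (N \<longlongrightarrow> 0) at_infinity"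

definition abelian_higgs ::
  "real \<Rightarrow> nat \<Rightarrow> (nat \<Rightarrow> real ^ 2) \<Rightarrow> (nat \<Rightarrow> nat) \<Rightarrow> (real ^ 2 \<Rightarrow> real) \<Rightarrow> bool" where
  "abelian_higgs q m z n w \<longleftrightarrow>
     smooth_H2 w \<and>
     (\<forall>x. laplacian w x = 2 * q\<^sup>2 * (exp_vf m z n w x - 1) + vortex_g m z n x)"

text \<open>The last alternative compares \<open>v\<close> with the finite energy Abelian Higgs solution, which is
  unique.\<close>

definition admissible ::
  "real \<Rightarrow> real \<Rightarrow> nat \<Rightarrow> (nat \<Rightarrow> real ^ 2) \<Rightarrow> (nat \<Rightarrow> nat) \<Rightarrow>
     (real ^ 2 \<Rightarrow> real) \<Rightarrow> (real ^ 2 \<Rightarrow> real) \<Rightarrow> bool" where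
  "admissible q \<kappa> m z n v A0 \<longleftrightarrow>
     (\<forall>x. A0 x \<le> 0) \<or>
     (\<forall>x. x \<notin> z ` {1..m} \<longrightarrow> v x \<le> - vortex_f m z n x) \<or>
     (\<forall>x. A0 x \<ge> q / \<kappa> * (exp_vf m z n v x - 1)) \<or>
     (\<exists>w. abelian_higgs q m z n w \<and> (\<forall>x. v x \<le> w x))"

end

theory Submission
  imports Defs
begin

text \<open>Everything follows from the maximum principle. Admissibility gives \<open>|\<phi>| \<le> 1\<close>, through a
  Keller--Osserman barrier or directly, and then \<open>A\<^sub>0 \<le> 0\<close>. Far out, the combination
  \<open>W = - ln |\<phi>|\<^sup>2 + (2 \<gamma> / \<rho>) N\<close>, a left eigenvector of the linearised system, satisfies
  \<open>\<Delta>W \<ge> q\<^sup>2 (1 - \<gamma>) W\<close> and is compared with a multiple of \<open>exp (- q \<surd>(1 - \<gamma>) |x|)\<close>; both of its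
  summands are nonnegative. An interior gradient estimate for the Laplacian transfers the decay to
  the derivatives of \<open>ln |\<phi>|\<^sup>2\<close> and \<open>A\<^sub>0\<close>, and the self-duality equation turns the former into
  the covariant derivatives of \<open>\<phi>\<close>.\<close>

section \<open>Partial derivatives and the maximum principle\<close>

text \<open>Neither field can be compared alone: with P = |phi|^2, the Laplacian of - ln P is 2 q^2
  (1 - P) - 2 q \<kappa> N and that of N is - \<kappa> q (1 - P) + (\<kappa>^2 + 2 q^2 P) N, and in
  each the coupling term has the sign that spoils a lower bound. Linearised at P = 1, N = 0 this is
  a 2 x 2 system with characteristic equation 2 \<gamma>^2 + \<rho>^2 \<gamma> = \<rho>^2 for the
  eigenvalue 2 q^2 (1 - \<gamma>). Its positive root gives the smaller eigenvalue and a left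
  eigenvector with positive entries, so a bound on the combination bounds both fields. The rate
  aimed at uses only half of that eigenvalue; the other half pays for the nonlinear terms. The
  formula for the Laplacian of ln P is itself derived from the self-duality equation, and only away
  from the zeros of phi. The maximum principle is therefore set up for functions on open sets with
  derivatives along the axes only.\<close>

definition has_pd :: "2 \<Rightarrow> (real ^ 2 \<Rightarrow> real) \<Rightarrow> real \<Rightarrow> real ^ 2 \<Rightarrow> bool" where
  "has_pd j F D x \<longleftrightarrow> ((\<lambda>t. F (x + t *\<^sub>R axis j 1)) has_real_derivative D) (at 0)"

text \<open>Derivatives are named by a relation along coordinate lines, so logarithms and barriers
  need no total derivative. \<open>G j\<close> and \<open>H j\<close> are the first and the pure
  second derivatives, and the Laplacian is \<open>H 1 x + H 2 x\<close>; mixed derivatives do not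
  enter a maximum argument.\<close>

definition twice_pd ::
  "(real ^ 2) set \<Rightarrow> (real ^ 2 \<Rightarrow> real) \<Rightarrow> (2 \<Rightarrow> real ^ 2 \<Rightarrow> real) \<Rightarrow> (2 \<Rightarrow> real ^ 2 \<Rightarrow> real) \<Rightarrow> bool"
  where "twice_pd S F G H \<longleftrightarrow> (\<forall>x\<in>S. \<forall>j. has_pd j F (G j x) x \<and> has_pd j (G j) (H j x) x)"

lemma has_pd_eq: "has_pd j F D x \<Longrightarrow> D = E \<Longrightarrow> has_pd j F E x"
  by simp

lemma has_pd_line:
  "has_pd j F D (x + s *\<^sub>R axis j 1) \<longleftrightarrow>
     ((\<lambda>t. F (x + t *\<^sub>R axis j 1)) has_real_derivative D) (at s)"
proof -
  have "(\<lambda>t. F (x + s *\<^sub>R axis j 1 + t *\<^sub>R axis j 1)) = (\<lambda>t. F (x + (t + s) *\<^sub>R axis j 1))"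
    by (simp add: scaleR_add_left add_ac)
  then show ?thesis
    unfolding has_pd_def by (simp add: DERIV_shift[of _ D 0 s, simplified])
qed

lemma has_pd_const: "has_pd j (\<lambda>x. c) 0 x"
  by (simp add: has_pd_def)

lemma has_pd_coord: "has_pd j (\<lambda>x. x $ i) (if i = j then 1 else 0) x"
  unfolding has_pd_def by (auto simp: axis_def intro!: derivative_eq_intros)

lemma has_pd_add: "has_pd j F D x \<Longrightarrow> has_pd j G E x \<Longrightarrow> has_pd j (\<lambda>x. F x + G x) (D + E) x"
  unfolding has_pd_def by (auto intro!: derivative_eq_intros)

lemma has_pd_diff: "has_pd j F D x \<Longrightarrow> has_pd j G E x \<Longrightarrow> has_pd j (\<lambda>x. F x - G x) (D - E) x"
  unfolding has_pd_def by (auto intro!: derivative_eq_intros)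

lemma has_pd_cmult: "has_pd j F D x \<Longrightarrow> has_pd j (\<lambda>x. c * F x) (c * D) x"
  unfolding has_pd_def by (auto intro!: derivative_eq_intros)

lemma has_pd_mult:
  "has_pd j F D x \<Longrightarrow> has_pd j G E x \<Longrightarrow> has_pd j (\<lambda>x. F x * G x) (D * G x + F x * E) x"
  unfolding has_pd_def by (auto intro!: derivative_eq_intros)

lemma has_pd_chain:
  assumes "has_pd j F D x" "(g has_real_derivative E) (at (F x))"
  shows "has_pd j (\<lambda>x. g (F x)) (E * D) x"
  unfolding has_pd_def
  using DERIV_chain2[where f = g and g = "\<lambda>t. F (x + t *\<^sub>R axis j 1)" and x = 0 and s = UNIV]
    assms unfolding has_pd_def by simp

lemma has_pd_divide:
  assumes "has_pd j F D x" "has_pd j G E x" "G x \<noteq> 0"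
  shows "has_pd j (\<lambda>x. F x / G x) ((D * G x - F x * E) / (G x * G x)) x"
  using assms unfolding has_pd_def by (auto intro!: derivative_eq_intros)

lemma has_pd_sum:
  "(\<And>i. i \<in> I \<Longrightarrow> has_pd j (F i) (D i) x) \<Longrightarrow> has_pd j (\<lambda>x. \<Sum>i\<in>I. F i x) (\<Sum>i\<in>I. D i) x"
  unfolding has_pd_def by (auto intro!: DERIV_sum)

lemma has_pd_cong_open:
  assumes "has_pd j F D x" "open S" "x \<in> S" "\<And>y. y \<in> S \<Longrightarrow> F y = G y"
  shows "has_pd j G D x"
proof -
  have "((\<lambda>t. x + t *\<^sub>R axis j 1) \<longlongrightarrow> x + 0 *\<^sub>R axis j 1) (nhds 0)"
    by (intro tendsto_intros) (simp add: filterlim_ident)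
  then have "\<forall>\<^sub>F t in nhds 0. x + t *\<^sub>R axis j 1 \<in> S"
    using assms(2,3) topological_tendstoD by fastforce
  then have "\<forall>\<^sub>F t in nhds 0. F (x + t *\<^sub>R axis j 1) = G (x + t *\<^sub>R axis j 1)"
    by eventually_elim (use assms(4) in auto)
  then show ?thesis
    using assms(1) unfolding has_pd_def by (simp cong: DERIV_cong_ev)
qed

lemma has_pd_dist_sq:
  "has_pd j (\<lambda>x. (norm (x - a))\<^sup>2) (2 * (x $ j - a $ j)) x"
proof -
  have "(norm (x - a))\<^sup>2 = (x $ 1 - a $ 1) * (x $ 1 - a $ 1) + (x $ 2 - a $ 2) * (x $ 2 - a $ 2)" for x
    unfolding power2_norm_eq_inner inner_vec_def by (simp add: sum_2)
  then show ?thesis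
    unfolding has_pd_def using exhaust_2[of j]
    by (auto intro!: derivative_eq_intros simp: axis_def)
qed

lemma twice_pd_subset: "twice_pd S F G H \<Longrightarrow> T \<subseteq> S \<Longrightarrow> twice_pd T F G H"
  by (auto simp: twice_pd_def)

lemma twice_pd_diff:
  "twice_pd S F G H \<Longrightarrow> twice_pd S F' G' H' \<Longrightarrow>
    twice_pd S (\<lambda>x. F x - F' x) (\<lambda>j x. G j x - G' j x) (\<lambda>j x. H j x - H' j x)"
  by (simp add: twice_pd_def has_pd_diff)

lemma twice_pd_add:
  "twice_pd S F G H \<Longrightarrow> twice_pd S F' G' H' \<Longrightarrow>
    twice_pd S (\<lambda>x. F x + F' x) (\<lambda>j x. G j x + G' j x) (\<lambda>j x. H j x + H' j x)"
  by (simp add: twice_pd_def has_pd_add)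

lemma twice_pd_cmult:
  "twice_pd S F G H \<Longrightarrow> twice_pd S (\<lambda>x. c * F x) (\<lambda>j x. c * G j x) (\<lambda>j x. c * H j x)"
  by (simp add: twice_pd_def has_pd_cmult)

text \<open>At the maximum \<open>g 0 = 0\<close>; if \<open>c\<close> were positive,
  \<open>g\<close> would be positive just to the right of 0 and \<open>f\<close> would increase
  there.\<close>

lemma DERIV2_local_max:
  fixes f g :: "real \<Rightarrow> real"
  assumes d: "d > 0" and f: "\<And>t. \<bar>t\<bar> < d \<Longrightarrow> (f has_real_derivative g t) (at t)"
    and g: "(g has_real_derivative c) (at 0)" and m: "\<And>t. \<bar>t\<bar> < d \<Longrightarrow> f t \<le> f 0"
  shows "c \<le> 0"
proof (rule ccontr)
  assume "\<not> c \<le> 0"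
  then have "c > 0" by simp
  have g0: "g 0 = 0"
    using DERIV_local_max[OF f[of 0] d] m d by auto
  obtain e where e: "e > 0" "\<And>h. h > 0 \<Longrightarrow> h < e \<Longrightarrow> g h > 0"
    using DERIV_pos_inc_right[OF g \<open>c > 0\<close>] g0 by auto
  define h where "h = min d e / 2"
  have h: "h > 0" "h < d" "h < e"
    using d e(1) by (auto simp: h_def)
  have "f 0 < f h"
  proof (rule DERIV_pos_imp_increasing_open[OF h(1)])
    show "\<exists>y. (f has_real_derivative y) (at x) \<and> 0 < y" if "0 < x" "x < h" for x
      using f[of x] e(2)[of x] that h by (intro exI[of _ "g x"]) auto
    show "continuous_on {0..h} f"
    proof (rule DERIV_continuous_on[where D = g])
      show "(f has_real_derivative g t) (at t within {0..h})" if "t \<in> {0..h}" for t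
        using f[of t] that h has_field_derivative_at_within by auto
    qed
  qed
  then show False using m[of h] h by simp
qed

lemma twice_pd_local_max:
  assumes "twice_pd S F G H" "open S" "y \<in> S" "open T" "y \<in> T" "\<And>x. x \<in> T \<Longrightarrow> F x \<le> F y"
  shows "H j y \<le> 0"
proof -
  obtain d where d: "d > 0" "ball y d \<subseteq> S \<inter> T"
    using assms(2-5) by (meson IntI open_Int open_contains_ball)
  have in_ST: "y + t *\<^sub>R axis j 1 \<in> S \<inter> T" if "\<bar>t\<bar> < d" for t
    using that d(2) by (intro subsetD[OF d(2)]) (simp add: dist_norm norm_axis_1)
  show ?thesis
  proof (rule DERIV2_local_max[OF d(1), where f = "\<lambda>t. F (y + t *\<^sub>R axis j 1)"
        and g = "\<lambda>t. G j (y + t *\<^sub>R axis j 1)"])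
    show "((\<lambda>t. F (y + t *\<^sub>R axis j 1)) has_real_derivative G j (y + t *\<^sub>R axis j 1)) (at t)"
      if "\<bar>t\<bar> < d" for t
      using in_ST[OF that] assms(1) unfolding twice_pd_def has_pd_line[symmetric] by blast
    show "((\<lambda>t. G j (y + t *\<^sub>R axis j 1)) has_real_derivative H j y) (at 0)"
      using assms(1,3) unfolding twice_pd_def has_pd_def by blast
    show "F (y + t *\<^sub>R axis j 1) \<le> F (y + 0 *\<^sub>R axis j 1)" if "\<bar>t\<bar> < d" for t
      using in_ST[OF that] assms(6) by simp
  qed
qed

text \<open>Outside the ball of radius \<open>R\<close> all values lie below \<open>F x0\<close>, so
  the maximum over the compact part inside the ball is global.\<close>

lemma attains_sup_closed:
  fixes F :: "real ^ 2 \<Rightarrow> real"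
  assumes "closed K" "continuous_on K F" "x0 \<in> K" "\<And>x. x \<in> K \<Longrightarrow> norm x > R \<Longrightarrow> F x < F x0"
  obtains y where "y \<in> K" "\<And>x. x \<in> K \<Longrightarrow> F x \<le> F y"
proof -
  have "x0 \<in> K \<inter> cball 0 R"
    using assms(3) assms(4)[of x0] by (auto simp: not_less[symmetric])
  moreover have "compact (K \<inter> cball 0 R)"
    using assms(1) by (simp add: closed_Int_compact)
  moreover have "continuous_on (K \<inter> cball 0 R) F"
    using assms(2) continuous_on_subset by blast
  ultimately obtain y where y: "y \<in> K \<inter> cball 0 R" "\<And>x. x \<in> K \<inter> cball 0 R \<Longrightarrow> F x \<le> F y"
    using continuous_attains_sup[of "K \<inter> cball 0 R" F] by blast
  have "F x \<le> F y" if "x \<in> K" for x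
  proof (cases "norm x \<le> R")
    case True then show ?thesis using y(2) that by auto
  next
    case False
    then have "F x < F x0" using assms(4) that by auto
    also have "F x0 \<le> F y" using y(2) \<open>x0 \<in> K \<inter> cball 0 R\<close> by auto
    finally show ?thesis by simp
  qed
  with y(1) show ?thesis using that by auto
qed

text \<open>A positive value would force a positive maximum to be attained, by \<open>inf\<close>,
  and in \<open>S\<close>, by \<open>bd\<close>; there both second derivatives are nonpositive,
  against \<open>lap\<close>. One statement serves bounded sets, where \<open>inf\<close> is
  vacuous, exteriors of discs and the whole plane.\<close>

lemma max_principle:
  fixes F :: "real ^ 2 \<Rightarrow> real"
  assumes K: "closed K" "continuous_on K F" and S: "open S" "S \<subseteq> K" "twice_pd S F G H"
    and bd: "\<And>x. x \<in> K - S \<Longrightarrow> F x \<le> 0"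
    and inf: "\<And>e. e > 0 \<Longrightarrow> \<exists>R. \<forall>x\<in>K. norm x > R \<longrightarrow> F x < e"
    and lap: "\<And>x. x \<in> S \<Longrightarrow> F x > 0 \<Longrightarrow> H 1 x + H 2 x > 0"
    and x: "x \<in> K"
  shows "F x \<le> 0"
proof (rule ccontr)
  assume "\<not> F x \<le> 0"
  then have pos: "F x > 0" by simp
  then obtain R where "\<forall>y\<in>K. norm y > R \<longrightarrow> F y < F x" using inf by blast
  then obtain y where y: "y \<in> K" "\<And>x. x \<in> K \<Longrightarrow> F x \<le> F y"
    using attains_sup_closed[OF K x] by metis
  have Fy: "F y > 0" using y(2)[OF x] pos by simp
  then have yS: "y \<in> S" using bd[of y] y(1) by fastforce
  have "H j y \<le> 0" for j
    using twice_pd_local_max[OF S(3,1) yS S(1) yS] y(2) S(2) by blast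
  then have "H 1 y + H 2 y \<le> 0" by (simp add: add_nonpos_nonpos)
  with lap[OF yS Fy] show False by simp
qed

section \<open>Two barriers\<close>

lemma has_pd_power:
  "has_pd j F D x \<Longrightarrow> has_pd j (\<lambda>x. F x ^ n) (real n * F x ^ (n - 1) * D) x"
  by (rule has_pd_chain[where g = "\<lambda>s. s ^ n"]) (auto intro!: derivative_eq_intros)

lemma sum_sq_coords: "(y $ 1 - a $ 1)\<^sup>2 + (y $ 2 - a $ 2)\<^sup>2 = (norm (y - a))\<^sup>2"
  for y a :: "real ^ 2"
  unfolding power2_norm_eq_inner inner_vec_def by (simp add: sum_2 power2_eq_square)

text \<open>With w = 1 / (b - |x - a|^2), differentiation gives 2 (x_j - a_j) w^2, so everything
  stays polynomial in w. The exponent 2 is the one for which two derivatives and squaring both lead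
  to w^4.\<close>

lemma twice_pd_blowup:
  "twice_pd {x. (norm (x - a))\<^sup>2 < b} (\<lambda>x. K * (1 / (b - (norm (x - a))\<^sup>2)) ^ 2)
     (\<lambda>j x. 4 * K * (x $ j - a $ j) * (1 / (b - (norm (x - a))\<^sup>2)) ^ 3)
     (\<lambda>j x. 4 * K * (1 / (b - (norm (x - a))\<^sup>2)) ^ 3
        + 24 * K * (x $ j - a $ j)\<^sup>2 * (1 / (b - (norm (x - a))\<^sup>2)) ^ 4)"
  unfolding twice_pd_def
proof safe
  fix x j assume x: "(norm (x - a))\<^sup>2 < b"
  let ?w = "\<lambda>x. 1 / (b - (norm (x - a))\<^sup>2)"
  have w: "has_pd j ?w (2 * (x $ j - a $ j) * ?w x ^ 2) x"
    using x by (intro has_pd_eq[OF has_pd_divide[OF has_pd_const has_pd_diff[OF has_pd_const has_pd_dist_sq]]])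
      (auto simp: power2_eq_square)
  show "has_pd j (\<lambda>x. K * ?w x ^ 2) (4 * K * (x $ j - a $ j) * ?w x ^ 3) x"
    by (rule has_pd_eq[OF has_pd_cmult[OF has_pd_power[OF w]]])
      (simp add: power2_eq_square power3_eq_cube algebra_simps)
  have c: "has_pd j (\<lambda>x. 4 * K * (x $ j - a $ j)) (4 * K) x"
    by (rule has_pd_eq[OF has_pd_cmult[OF has_pd_diff[OF has_pd_coord has_pd_const]]]) simp
  show "has_pd j (\<lambda>x. 4 * K * (x $ j - a $ j) * ?w x ^ 3)
      (4 * K * ?w x ^ 3 + 24 * K * (x $ j - a $ j)\<^sup>2 * ?w x ^ 4) x"
    by (rule has_pd_eq[OF has_pd_mult[OF c has_pd_power[OF w]]])
      (simp add: power2_eq_square power3_eq_cube power4_eq_xxxx algebra_simps)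
qed

text \<open>A Keller--Osserman argument: since the right-hand side grows quadratically in \<open>ln P\<close>, a barrier
  that blows up on a large circle replaces any assumption at infinity.\<close>

lemma Keller_Osserman:
  fixes P :: "real ^ 2 \<Rightarrow> real"
  assumes q: "q > 0" and cont: "continuous_on UNIV P"
    and pd: "twice_pd {x. P x > 1} (\<lambda>x. ln (P x)) G H"
    and lap: "\<And>x. P x > 1 \<Longrightarrow> H 1 x + H 2 x \<ge> 2 * q\<^sup>2 * (P x - 1)"
  shows "P x0 \<le> 1"
proof (rule ccontr)
  assume "\<not> P x0 \<le> 1"
  define h0 where "h0 = ln (P x0)"
  have h0: "h0 > 0" using \<open>\<not> P x0 \<le> 1\<close> by (simp add: h0_def)
  \<comment> \<open>\<open>K\<close> is chosen so that 24 b K = q^2 K^2, which bounds the Laplacian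
    of the barrier U by q^2 U^2; \<open>b\<close> is chosen so that U at \<open>x0\<close> is K /
    b^2 = h0 / 2, below \<open>ln (P x0)\<close>.\<close>
  define b where "b = 48 / (q\<^sup>2 * h0)"
  define K where "K = 24 / q\<^sup>2 * b"
  have b: "b > 0" and K: "K > 0" using h0 q by (auto simp: b_def K_def)
  have "compact (cball x0 (sqrt b))" by simp
  then have "\<exists>y\<in>cball x0 (sqrt b). \<forall>x\<in>cball x0 (sqrt b). P x \<le> P y"
    using cont b by (intro continuous_attains_sup) (auto intro: continuous_on_subset)
  then obtain y where "y \<in> cball x0 (sqrt b)" and
    y: "\<And>x. x \<in> cball x0 (sqrt b) \<Longrightarrow> P x \<le> P y" by blast
  define L where "L = ln (P y)"
  have "P x0 \<le> P y" using y[of x0] b by simp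
  then have L: "L > 0" using \<open>\<not> P x0 \<le> 1\<close> by (simp add: L_def)
  \<comment> \<open>Stopping at distance \<open>d\<close> from the blow-up keeps the barrier finite,
    while its value K / d^2 on that circle already exceeds or equals the bound \<open>L\<close> for
    \<open>ln P\<close>.\<close>
  define d where "d = min b (sqrt (K / L))"
  have d: "d > 0" "d \<le> b" using b K L by (auto simp: d_def)
  have "d\<^sup>2 \<le> (sqrt (K / L))\<^sup>2" using d by (intro power_mono) (auto simp: d_def)
  then have dL: "K * (1 / d) ^ 2 \<ge> L" using K L d by (simp add: field_simps power_divide)
  let ?s = "\<lambda>x. (norm (x - x0))\<^sup>2"
  let ?w = "\<lambda>x. 1 / (b - ?s x)"
  let ?U = "\<lambda>x. K * ?w x ^ 2"
  let ?K = "{x. 1 \<le> P x} \<inter> {x. ?s x \<le> b - d}"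
  let ?S = "{x. 1 < P x} \<inter> {x. ?s x < b - d}"
  have LP: "ln (P x) \<le> L" if "?s x \<le> b - d" "1 \<le> P x" for x
  proof -
    have "(dist x0 x)\<^sup>2 \<le> b" using that d by (simp add: dist_norm norm_minus_commute)
    then have "dist x0 x \<le> sqrt b" using real_le_rsqrt by blast
    with y[of x] that show ?thesis by (simp add: L_def)
  qed
  have "ln (P x0) - ?U x0 \<le> 0"
  proof (rule max_principle[where F = "\<lambda>x. ln (P x) - ?U x" and K = ?K and S = ?S])
    show "closed ?K"
      using cont by (intro closed_Int closed_Collect_le continuous_intros)
    show "continuous_on ?K (\<lambda>x. ln (P x) - ?U x)"
      using d by (intro continuous_intros continuous_on_subset[OF cont]) auto
    show "open ?S"
      using cont by (intro open_Int open_Collect_less continuous_intros)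
    show "?S \<subseteq> ?K" by auto
    show "twice_pd ?S (\<lambda>x. ln (P x) - ?U x) (\<lambda>j x. G j x - 4 * K * (x $ j - x0 $ j) * ?w x ^ 3)
        (\<lambda>j x. H j x - (4 * K * ?w x ^ 3 + 24 * K * (x $ j - x0 $ j)\<^sup>2 * ?w x ^ 4))"
      using d by (intro twice_pd_diff twice_pd_subset[OF pd] twice_pd_subset[OF twice_pd_blowup]) auto
    show "ln (P x) - ?U x \<le> 0" if "x \<in> ?K - ?S" for x
    proof (cases "P x = 1")
      case True
      then show ?thesis using K by simp
    next
      case False
      then have "?s x = b - d" using that by auto
      then have "?w x = 1 / d" by simp
      then have "?U x \<ge> L" using dL by simp
      then show ?thesis using LP[of x] that by simp
    qed
    show "\<exists>R. \<forall>x\<in>?K. R < norm x \<longrightarrow> ln (P x) - ?U x < e" if "e > 0" for e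
    proof (intro exI ballI impI)
      fix x assume x: "x \<in> ?K" "norm x0 + sqrt b < norm x"
      have "?s x \<le> b" using x d by auto
      then have "norm (x - x0) \<le> sqrt b" using real_le_rsqrt by blast
      with x(2) norm_triangle_sub[of x x0] show "ln (P x) - ?U x < e" by linarith
    qed
    show "x0 \<in> ?K" using \<open>\<not> P x0 \<le> 1\<close> d by simp
    show "0 < H 1 x - (4 * K * ?w x ^ 3 + 24 * K * (x $ 1 - x0 $ 1)\<^sup>2 * ?w x ^ 4) +
        (H 2 x - (4 * K * ?w x ^ 3 + 24 * K * (x $ 2 - x0 $ 2)\<^sup>2 * ?w x ^ 4))"
      if x: "x \<in> ?S" and pos: "0 < ln (P x) - ?U x" for x
    proof -
      define w where "w = ?w x"
      have w: "w > 0" using x d by (simp add: w_def)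
      have ws: "1 = w * (b - ?s x)" using x d by (simp add: w_def)
      have s: "0 \<le> ?s x" "?s x \<le> b" using x d by auto
      \<comment> \<open>Inserting \<open>1 = w * (b - ?s x)\<close> into the cubic term makes both
        terms of degree four in \<open>w\<close>, ready for comparison with the square of the
        barrier.\<close>
      have "8 * K * w ^ 3 + 24 * K * ?s x * w ^ 4 = 8 * K * w ^ 3 * (w * (b - ?s x)) + 24 * K * ?s x * w ^ 4"
        using ws by simp
      also have "\<dots> = K * w ^ 4 * (8 * b + 16 * ?s x)"
        by (simp add: algebra_simps power3_eq_cube power4_eq_xxxx)
      also have "\<dots> \<le> K * w ^ 4 * (24 * b)"
        using s K w by (intro mult_left_mono) auto
      also have "\<dots> = q\<^sup>2 * (K * w ^ 2)\<^sup>2"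
        using q by (simp add: K_def power2_eq_square power4_eq_xxxx field_simps)
      also have "\<dots> < q\<^sup>2 * (ln (P x))\<^sup>2"
        using pos K q w by (intro mult_strict_left_mono power_strict_mono) (auto simp: w_def)
      also have "\<dots> \<le> 2 * q\<^sup>2 * (P x - 1)"
      proof -
        have "1 + ln (P x) + (ln (P x))\<^sup>2 / 2 \<le> exp (ln (P x))"
          using x by (intro exp_lower_Taylor_quadratic) simp
        moreover have "exp (ln (P x)) = P x" "ln (P x) > 0" using x by auto
        ultimately have "(ln (P x))\<^sup>2 \<le> 2 * (P x - 1)" by argo
        then show ?thesis using q by (simp add: mult_left_mono mult.assoc mult.left_commute)
      qed
      also have "\<dots> \<le> H 1 x + H 2 x" using lap x by simp
      finally have "8 * K * w ^ 3 + 24 * K * ?s x * w ^ 4 < H 1 x + H 2 x" .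
      then show ?thesis
        unfolding sum_sq_coords[of x x0, symmetric] w_def by (simp add: algebra_simps)
    qed
  qed
  moreover have "?U x0 = h0 / 2"
    using h0 q by (simp add: K_def b_def power2_eq_square field_simps)
  ultimately show False using h0 by (simp add: h0_def)
qed

section \<open>The exponential barrier outside a disc\<close>

lemma has_pd_norm:
  assumes "x \<noteq> 0"
  shows "has_pd j norm (x $ j / norm x) x"
proof -
  have "has_pd j (\<lambda>x. sqrt ((norm (x - 0))\<^sup>2)) (inverse (sqrt ((norm (x - 0))\<^sup>2)) / 2 * (2 * (x $ j - 0 $ j))) x"
    using assms by (intro has_pd_chain[OF has_pd_dist_sq] DERIV_real_sqrt) auto
  then show ?thesis
    by (simp add: field_simps)
qed

lemma twice_pd_exp_norm:
  "twice_pd (- {0}) (\<lambda>x. exp (- s * norm x)) (\<lambda>j x. - s * (x $ j / norm x) * exp (- s * norm x))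
     (\<lambda>j x. s\<^sup>2 * (x $ j / norm x)\<^sup>2 * exp (- s * norm x)
        - s * (1 - (x $ j / norm x)\<^sup>2) / norm x * exp (- s * norm x))"
  unfolding twice_pd_def
proof safe
  fix x :: "real ^ 2" and j assume "x \<noteq> 0"
  note n = has_pd_norm[OF \<open>x \<noteq> 0\<close>, of j]
  have e: "has_pd j (\<lambda>x. exp (- s * norm x)) (- s * (x $ j / norm x) * exp (- s * norm x)) x"
    by (rule has_pd_eq[OF has_pd_chain[OF has_pd_cmult[OF n] DERIV_exp]]) simp
  then show "has_pd j (\<lambda>x. exp (- s * norm x)) (- s * (x $ j / norm x) * exp (- s * norm x)) x" .
  show "has_pd j (\<lambda>x. - s * (x $ j / norm x) * exp (- s * norm x))
     (s\<^sup>2 * (x $ j / norm x)\<^sup>2 * exp (- s * norm x)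
        - s * (1 - (x $ j / norm x)\<^sup>2) / norm x * exp (- s * norm x)) x"
    using \<open>x \<noteq> 0\<close>
    by (intro has_pd_eq[OF has_pd_mult[OF has_pd_cmult[OF has_pd_divide[OF has_pd_coord n]] e]])
      (auto simp: field_simps power2_eq_square)
qed

text \<open>The barrier exp (- s |x|) has Laplacian (s^2 - s / |x|) exp (- s |x|), at most s^2 times
  itself, so a multiple of it that dominates \<open>W\<close> on the circle of radius
  \<open>R\<close> dominates \<open>W\<close> outside: where the difference is positive, its
  Laplacian is positive.\<close>

lemma exponential_decay:
  fixes W :: "real ^ 2 \<Rightarrow> real"
  assumes R: "R > 0" and s: "s > 0"
    and pd: "twice_pd {x. norm x > R} W G H" and cont: "continuous_on {x. norm x \<ge> R} W"
    and lim: "(W \<longlongrightarrow> 0) at_infinity"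
    and lap: "\<And>x. norm x > R \<Longrightarrow> W x > 0 \<Longrightarrow> H 1 x + H 2 x \<ge> s\<^sup>2 * W x"
  obtains C where "C > 0" "\<And>x. norm x \<ge> R \<Longrightarrow> W x \<le> C * exp (- s * norm x)"
proof -
  have "compact (W ` sphere 0 R)"
    by (intro compact_continuous_image continuous_on_subset[OF cont]) auto
  then obtain M where M: "M > 0" "\<And>x. norm x = R \<Longrightarrow> norm (W x) \<le> M"
    unfolding compact_eq_bounded_closed bounded_pos by auto
  define C where "C = M * exp (s * R)"
  have C: "C > 0" using M by (simp add: C_def)
  have "W x - C * exp (- s * norm x) \<le> 0" if "norm x \<ge> R" for x
  proof (rule max_principle[where F = "\<lambda>x. W x - C * exp (- s * norm x)"
        and K = "{x. norm x \<ge> R}" and S = "{x. norm x > R}"])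
    show "closed {x :: real ^ 2. R \<le> norm x}" by (intro closed_Collect_le continuous_intros)
    show "open {x :: real ^ 2. R < norm x}" by (intro open_Collect_less continuous_intros)
    show "continuous_on {x. R \<le> norm x} (\<lambda>x. W x - C * exp (- s * norm x))"
      by (intro continuous_intros cont)
    show "{x :: real ^ 2. R < norm x} \<subseteq> {x. R \<le> norm x}" by auto
    show "twice_pd {x. norm x > R} (\<lambda>x. W x - C * exp (- s * norm x))
        (\<lambda>j x. G j x - C * (- s * (x $ j / norm x) * exp (- s * norm x)))
        (\<lambda>j x. H j x - C * (s\<^sup>2 * (x $ j / norm x)\<^sup>2 * exp (- s * norm x)
          - s * (1 - (x $ j / norm x)\<^sup>2) / norm x * exp (- s * norm x)))"
      using R by (intro twice_pd_diff twice_pd_cmult pd twice_pd_subset[OF twice_pd_exp_norm]) auto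
    show "W x - C * exp (- s * norm x) \<le> 0" if "x \<in> {x. R \<le> norm x} - {x. R < norm x}" for x
      using M(2)[of x] that by (auto simp: C_def exp_minus field_simps)
    show "\<exists>R'. \<forall>x\<in>{x. R \<le> norm x}. R' < norm x \<longrightarrow> W x - C * exp (- s * norm x) < e" if "e > 0" for e
    proof -
      have "\<forall>\<^sub>F x in at_infinity. W x < e"
        using lim that by (auto simp: order_tendsto_iff)
      then obtain b where b: "\<And>x. b \<le> norm x \<Longrightarrow> W x < e"
        unfolding eventually_at_infinity by blast
      have "W x - C * exp (- s * norm x) < e" if "b < norm x" for x
        using b[of x] that C by (smt (verit) exp_gt_zero mult_pos_pos)
      then show ?thesis by blast
    qed
    show "x \<in> {x. R \<le> norm x}" using that by simp
    fix x :: "real ^ 2"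
    assume "x \<in> {x. R < norm x}" and pos: "0 < W x - C * exp (- s * norm x)"
    then have x: "R < norm x" by simp
    let ?E = "exp (- s * norm x)" and ?c = "\<lambda>j. (x $ j / norm x)\<^sup>2"
    have c: "?c 1 + ?c 2 = 1"
    proof -
      have "x \<noteq> 0" using x R by auto
      then show ?thesis
        using sum_sq_coords[of x 0] by (simp add: power_divide add_divide_distrib[symmetric])
    qed
    \<comment> \<open>Here \<open>a\<close> and \<open>b\<close> stand for the squared direction
      cosines, whose sum 1 collapses the two axis contributions to the radial formula.\<close>
    have "(s\<^sup>2 * a * e - s * (1 - a) / t * e) + (s\<^sup>2 * b * e - s * (1 - b) / t * e)
        = s\<^sup>2 * e * (a + b) - s * (2 - (a + b)) / t * e" for a b e t :: real
      by (simp add: algebra_simps diff_divide_distrib add_divide_distrib)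
    then have "(s\<^sup>2 * ?c 1 * ?E - s * (1 - ?c 1) / norm x * ?E) + (s\<^sup>2 * ?c 2 * ?E - s * (1 - ?c 2) / norm x * ?E)
        = s\<^sup>2 * ?E * (?c 1 + ?c 2) - s * (2 - (?c 1 + ?c 2)) / norm x * ?E" .
    also have "\<dots> = s\<^sup>2 * ?E - s / norm x * ?E" using c by simp
    also have "\<dots> \<le> s\<^sup>2 * ?E" using s by simp
    finally have "C * ((s\<^sup>2 * ?c 1 * ?E - s * (1 - ?c 1) / norm x * ?E) + (s\<^sup>2 * ?c 2 * ?E - s * (1 - ?c 2) / norm x * ?E))
        \<le> C * (s\<^sup>2 * ?E)" using C by (intro mult_left_mono) auto
    moreover have "C * (s\<^sup>2 * ?E) < s\<^sup>2 * W x"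
      using pos s mult_strict_left_mono[of "C * ?E" "W x" "s\<^sup>2"] by (simp add: mult.left_commute)
    moreover have "s\<^sup>2 * W x \<le> H 1 x + H 2 x"
      using pos C by (intro lap x) (smt (verit) exp_gt_zero mult_pos_pos)
    ultimately show "0 < H 1 x - C * (s\<^sup>2 * ?c 1 * ?E - s * (1 - ?c 1) / norm x * ?E) +
        (H 2 x - C * (s\<^sup>2 * ?c 2 * ?E - s * (1 - ?c 2) / norm x * ?E))"
      by (simp add: algebra_simps)
  qed
  then show ?thesis using C that by force
qed

section \<open>Interior gradient estimate\<close>

text \<open>Reversing one coordinate flips the sign of the first derivative along it; a second
  derivative picks up the sign twice, so the Laplacian is carried along unchanged.\<close>

lemma twice_pd_reflect:
  fixes c :: real and j :: 2
  assumes "twice_pd S F G H"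
  defines "r \<equiv> \<lambda>y. y - (2 * (y $ j - c)) *\<^sub>R axis j 1"
  shows "twice_pd (r -` S) (\<lambda>y. F (r y)) (\<lambda>i y. (if i = j then - 1 else 1) * G i (r y)) (\<lambda>i y. H i (r y))"
proof -
  have r: "r (y + t *\<^sub>R axis i 1) = r y + (if i = j then - t else t) *\<^sub>R axis i 1" for y t i
    by (auto simp: r_def algebra_simps axis_def vec_eq_iff)
  have *: "has_pd i (\<lambda>y. F (r y)) ((if i = j then - 1 else 1) * D) y" if "has_pd i F D (r y)" for F D i y
  proof (cases "i = j")
    case True
    have "((\<lambda>t. F (r y + (- t) *\<^sub>R axis i 1)) has_real_derivative - D) (at 0)"
      using that unfolding has_pd_def by (subst DERIV_mirror[symmetric]) simp
    then show ?thesis unfolding has_pd_def r using True by simp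
  next
    case False
    then show ?thesis using that unfolding has_pd_def r by simp
  qed
  show ?thesis
    unfolding twice_pd_def
  proof safe
    fix y i assume y: "r y \<in> S"
    show "has_pd i (\<lambda>y. F (r y)) ((if i = j then - 1 else 1) * G i (r y)) y"
      using y assms(1) by (intro *) (auto simp: twice_pd_def)
    have "has_pd i (\<lambda>y. G i (r y)) ((if i = j then - 1 else 1) * H i (r y)) y"
      using y assms(1) by (intro *) (auto simp: twice_pd_def)
    then show "has_pd i (\<lambda>y. (if i = j then - 1 else 1) * G i (r y)) (H i (r y)) y"
      using has_pd_cmult[of i "\<lambda>y. G i (r y)" _ y "if i = j then - 1 else 1"] by (cases "i = j") fastforce+
  qed
qed

text \<open>Half the difference of \<open>F\<close> and its mirror image vanishes on the mirror line; an explicit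
  barrier on one half of the square then controls its normal derivative there.\<close>

lemma pd_upper_bound:
  fixes F :: "real ^ 2 \<Rightarrow> real"
  assumes jk: "j \<noteq> k" and d: "d > 0"
    and S: "open S" "\<And>y. (\<And>i. \<bar>y $ i - x $ i\<bar> \<le> d) \<Longrightarrow> y \<in> S"
    and pd: "twice_pd S F G H" and cont: "continuous_on S F"
    and M: "\<And>y. y \<in> S \<Longrightarrow> \<bar>F y\<bar> \<le> M" and N: "\<And>y. y \<in> S \<Longrightarrow> \<bar>H 1 y + H 2 y\<bar> < N"
  shows "G j x \<le> 2 * M / d + N * d / 2"
proof -
  define r where "r = (\<lambda>y :: real ^ 2. y - (2 * (y $ j - x $ j)) *\<^sub>R axis j 1)"
  have ijk: "i = j \<or> i = k" for i :: 2 using jk exhaust_2 by metis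
  have rj: "r y $ j - x $ j = - (y $ j - x $ j)" and rk: "r y $ k = y $ k" for y
    using jk by (auto simp: r_def axis_def)
  have refl: "twice_pd (r -` S) (\<lambda>y. F (r y)) (\<lambda>i y. (if i = j then - 1 else 1) * G i (r y)) (\<lambda>i y. H i (r y))"
    unfolding r_def by (rule twice_pd_reflect[OF pd])
  \<comment> \<open>Let s be the coordinate along the mirror and t the distance from it. The first
    summand is harmonic and at least \<open>M\<close> on the sides |s| = d and t = d of the half
    square; the second is nonnegative there and has Laplacian \<open>- N\<close>, which absorbs that
    of \<open>F\<close>. The normal derivative of the sum at \<open>x\<close> is the claimed
    bound.\<close>
  define \<psi> where "\<psi> = (\<lambda>y. M / d\<^sup>2 * ((y $ k - x $ k)\<^sup>2 + (y $ j - x $ j) * (2 * d - (y $ j - x $ j)))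
      + N / 2 * ((y $ j - x $ j) * (d - (y $ j - x $ j))))"
  define G\<psi> where "G\<psi> = (\<lambda>i y. if i = k then M / d\<^sup>2 * (2 * (y $ k - x $ k))
      else M / d\<^sup>2 * (2 * d - 2 * (y $ j - x $ j)) + N / 2 * (d - 2 * (y $ j - x $ j)))"
  define H\<psi> where "H\<psi> = (\<lambda>i (y :: real ^ 2). if i = k then 2 * M / d\<^sup>2 else - 2 * M / d\<^sup>2 - N)"
  have pd\<psi>: "twice_pd UNIV \<psi> G\<psi> H\<psi>"
    unfolding twice_pd_def
  proof safe
    fix y i
    have cj: "has_pd i (\<lambda>y. y $ j - x $ j) (if i = k then 0 else 1) y"
      and ck: "has_pd i (\<lambda>y. y $ k - x $ k) (if i = k then 1 else 0) y"
      using ijk[of i] jk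
      by (intro has_pd_eq[OF has_pd_diff[OF has_pd_coord has_pd_const]]; auto)+
    show "has_pd i \<psi> (G\<psi> i y) y"
      unfolding \<psi>_def
      by (rule has_pd_eq[OF has_pd_add[OF
          has_pd_cmult[OF has_pd_add[OF has_pd_power[OF ck] has_pd_mult[OF cj has_pd_diff[OF has_pd_const cj]]]]
          has_pd_cmult[OF has_pd_mult[OF cj has_pd_diff[OF has_pd_const cj]]]]])
        (auto simp: G\<psi>_def algebra_simps)
    show "has_pd i (G\<psi> i) (H\<psi> i y) y"
    proof (cases "i = k")
      case True
      show ?thesis
        unfolding G\<psi>_def if_P[OF True]
        by (rule has_pd_eq[OF has_pd_cmult[OF has_pd_cmult[OF ck]]]) (auto simp: H\<psi>_def True)
    next
      case False
      show ?thesis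
        unfolding G\<psi>_def if_not_P[OF False]
        by (rule has_pd_eq[OF has_pd_add[OF
            has_pd_cmult[OF has_pd_diff[OF has_pd_const has_pd_cmult[OF cj]]]
            has_pd_cmult[OF has_pd_diff[OF has_pd_const has_pd_cmult[OF cj]]]]])
          (auto simp: H\<psi>_def False)
    qed
  qed
  have M0: "M \<ge> 0" and N0: "N > 0"
    using M[of x] N[of x] S(2)[of x] d by fastforce+
  let ?K = "{y. \<bar>y $ k - x $ k\<bar> \<le> d} \<inter> ({y. x $ j \<le> y $ j} \<inter> {y. y $ j \<le> x $ j + d})"
  let ?S = "{y. \<bar>y $ k - x $ k\<bar> < d} \<inter> ({y. x $ j < y $ j} \<inter> {y. y $ j < x $ j + d})"
  let ?F = "\<lambda>y. 1 / 2 * (F y - F (r y)) - \<psi> y"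
  have KS: "y \<in> S" "r y \<in> S" if "y \<in> ?K" for y
  proof -
    have "\<bar>y $ i - x $ i\<bar> \<le> d" for i using ijk[of i] that by auto
    then show "y \<in> S" by (rule S(2))
    have "\<bar>r y $ i - x $ i\<bar> \<le> d" for i using ijk[of i] that rj[of y] rk[of y] by auto
    then show "r y \<in> S" by (rule S(2))
  qed
  have main: "?F y \<le> 0" if "y \<in> ?K" for y
  proof (rule max_principle[where F = ?F and K = ?K and S = ?S])
    show "closed ?K"
      by (intro closed_Int closed_Collect_le continuous_intros)
    have "continuous_on ?K (\<lambda>y. F (r y))"
      by (rule continuous_on_compose2[OF cont])
        (use KS(2) in \<open>auto simp: r_def intro!: continuous_intros\<close>)
    then show "continuous_on ?K ?F"
      using KS(1) unfolding \<psi>_def by (intro continuous_intros continuous_on_subset[OF cont]) auto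
    show "open ?S"
      by (intro open_Int open_Collect_less continuous_intros)
    show "?S \<subseteq> ?K" by auto
    then have "?S \<subseteq> S" "?S \<subseteq> r -` S" using KS by blast+
    then show "twice_pd ?S ?F (\<lambda>i y. 1 / 2 * (G i y - (if i = j then - 1 else 1) * G i (r y)) - G\<psi> i y)
        (\<lambda>i y. 1 / 2 * (H i y - H i (r y)) - H\<psi> i y)"
      by (intro twice_pd_diff twice_pd_cmult twice_pd_subset[OF pd] twice_pd_subset[OF pd\<psi>]
          twice_pd_subset[OF refl]) auto
    show "?F y \<le> 0" if y: "y \<in> ?K - ?S" for y
    proof -
      have b: "\<bar>F y\<bar> \<le> M" "\<bar>F (r y)\<bar> \<le> M" using KS[of y] M y by auto
      define s t where "s = y $ k - x $ k" and "t = y $ j - x $ j"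
      have st: "\<bar>s\<bar> \<le> d" "0 \<le> t" "t \<le> d" using y by (auto simp: s_def t_def)
      have ps: "\<psi> y = M / d\<^sup>2 * (s\<^sup>2 + t * (2 * d - t)) + N / 2 * (t * (d - t))"
        by (simp add: \<psi>_def s_def t_def)
      have n: "N / 2 * (t * (d - t)) \<ge> 0" using st N0 by simp
      have tt: "t * (2 * d - t) \<ge> 0" using st by simp
      consider "t = 0" | "d\<^sup>2 \<le> s\<^sup>2 + t * (2 * d - t)"
      proof -
        assume *: "t = 0 \<Longrightarrow> thesis" "d\<^sup>2 \<le> s\<^sup>2 + t * (2 * d - t) \<Longrightarrow> thesis"
        have "\<bar>s\<bar> = d \<or> t = 0 \<or> t = d" using y st by (auto simp: s_def t_def)
        then show thesis
        proof (elim disjE)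
          assume "\<bar>s\<bar> = d"
          then have "s\<^sup>2 = d\<^sup>2" by (metis power2_abs)
          then show thesis using tt * by simp
        qed (use * in \<open>auto simp: power2_eq_square\<close>)
      qed
      then show ?thesis
      proof cases
        case 1
        then have "r y = y" by (simp add: r_def t_def)
        moreover have "\<psi> y \<ge> 0" using 1 M0 by (simp add: ps)
        ultimately show ?thesis by simp
      next
        case 2
        have "M = M / d\<^sup>2 * d\<^sup>2" using d by simp
        also have "\<dots> \<le> M / d\<^sup>2 * (s\<^sup>2 + t * (2 * d - t))"
          using 2 M0 by (intro mult_left_mono) auto
        finally have "\<psi> y \<ge> M" using n ps by simp
        then show ?thesis using b by (simp add: field_simps)
      qed
    qed
    show "\<exists>R. \<forall>y\<in>?K. R < norm y \<longrightarrow> ?F y < e" for e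
    proof (intro exI ballI impI)
      fix y assume y: "y \<in> ?K" "norm x + 2 * d < norm y"
      have "norm (y - x) \<le> \<bar>(y - x) $ 1\<bar> + \<bar>(y - x) $ 2\<bar>"
        using norm_le_l1_cart[of "y - x"] by (simp add: sum_2)
      moreover have "\<bar>(y - x) $ i\<bar> \<le> d" for i using ijk[of i] y by auto
      from this[of 1] this[of 2] calculation have "norm (y - x) \<le> 2 * d" by linarith
      with y(2) norm_triangle_sub[of y x] show "?F y < e" by linarith
    qed
    show "y \<in> ?K" by fact
    show "0 < 1 / 2 * (H 1 y - H 1 (r y)) - H\<psi> 1 y + (1 / 2 * (H 2 y - H 2 (r y)) - H\<psi> 2 y)"
      if "y \<in> ?S" for y
    proof -
      have "\<bar>H 1 y + H 2 y\<bar> < N" "\<bar>H 1 (r y) + H 2 (r y)\<bar> < N"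
        using KS[of y] that N by auto
      moreover have "H\<psi> 1 y + H\<psi> 2 y = - N"
        using jk exhaust_2[of j] exhaust_2[of k] by (auto simp: H\<psi>_def)
      ultimately show ?thesis by (simp add: abs_less_iff field_simps)
    qed
  qed
  \<comment> \<open>\<open>D\<close> vanishes at 0 and is nonnegative for small positive t, so its
    derivative at 0 cannot be negative. Reflection doubles the contribution of \<open>G j x\<close>,
    hence the factor 2 on \<psi>.\<close>
  define D where "D = (\<lambda>t. 2 * \<psi> (x + t *\<^sub>R axis j 1) - (F (x + t *\<^sub>R axis j 1) - F (r (x + t *\<^sub>R axis j 1))))"
  have xS: "x \<in> S" using S(2)[of x] d by simp
  have "r x = x" by (simp add: r_def)
  have "has_pd j (\<lambda>y. 2 * \<psi> y - (F y - F (r y))) (2 * G\<psi> j x - (G j x - (- G j x))) x"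
  proof (intro has_pd_diff has_pd_cmult)
    show "has_pd j \<psi> (G\<psi> j x) x" using pd\<psi> by (simp add: twice_pd_def)
    show "has_pd j F (G j x) x" using pd xS by (simp add: twice_pd_def)
    have "x \<in> r -` S" using xS \<open>r x = x\<close> by simp
    then have "has_pd j (\<lambda>y. F (r y)) ((if j = j then - 1 else 1) * G j (r x)) x"
      using refl unfolding twice_pd_def by blast
    then show "has_pd j (\<lambda>y. F (r y)) (- G j x) x" using \<open>r x = x\<close> by simp
  qed
  then have der: "(D has_real_derivative 2 * G\<psi> j x - 2 * G j x) (at 0)"
    unfolding has_pd_def D_def by simp
  have "0 \<le> 2 * G\<psi> j x - 2 * G j x"
  proof (rule ccontr)
    assume "\<not> 0 \<le> 2 * G\<psi> j x - 2 * G j x"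
    then obtain e where e: "e > 0" "\<And>h. h > 0 \<Longrightarrow> h < e \<Longrightarrow> D 0 > D h"
      using DERIV_neg_dec_right[OF der] by auto
    define h where "h = min e d / 2"
    have h: "h > 0" "h < e" "h < d" using e(1) d by (auto simp: h_def)
    have "D 0 = 0" using \<open>r x = x\<close> by (simp add: D_def \<psi>_def)
    moreover have "D h \<ge> 0"
      using main[of "x + h *\<^sub>R axis j 1"] h d jk by (simp add: D_def axis_def)
    ultimately show False using e(2)[of h] h by simp
  qed
  then have "G j x \<le> G\<psi> j x" by simp
  also have "\<dots> = 2 * M / d + N * d / 2"
    using d jk by (simp add: G\<psi>_def power2_eq_square)
  finally show ?thesis .
qed

lemma pd_bound:
  fixes F :: "real ^ 2 \<Rightarrow> real"
  assumes d: "d > 0"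
    and S: "open S" "\<And>y. (\<And>i. \<bar>y $ i - x $ i\<bar> \<le> d) \<Longrightarrow> y \<in> S"
    and pd: "twice_pd S F G H" and cont: "continuous_on S F"
    and M: "\<And>y. y \<in> S \<Longrightarrow> \<bar>F y\<bar> \<le> M" and N: "\<And>y. y \<in> S \<Longrightarrow> \<bar>H 1 y + H 2 y\<bar> < N"
  shows "\<bar>G j x\<bar> \<le> 2 * M / d + N * d / 2"
proof -
  obtain k where k: "j \<noteq> k" using exhaust_2 by (metis zero_neq_one)
  have "- G j x \<le> 2 * M / d + N * d / 2"
  proof (rule pd_upper_bound[OF k d S])
    show "twice_pd S (\<lambda>y. - F y) (\<lambda>j y. - G j y) (\<lambda>j y. - H j y)"
      using twice_pd_cmult[OF pd, of "- 1"] by simp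
    show "\<bar>- H 1 y + - H 2 y\<bar> < N" if "y \<in> S" for y
      using N[OF that] by linarith
  qed (use cont M in \<open>auto intro: continuous_intros\<close>)
  moreover have "G j x \<le> 2 * M / d + N * d / 2"
    by (rule pd_upper_bound[OF k d S pd cont M N])
  ultimately show ?thesis by linarith
qed

section \<open>Self-dual gauge fields\<close>

lemma smooth_pd: "smooth f \<Longrightarrow> smooth (pd j f)"
  unfolding smooth_def
proof
  fix js assume *: "\<forall>js. foldr pd js f differentiable_on UNIV"
  show "foldr pd js (pd j f) differentiable_on UNIV"
    using *[rule_format, of "js @ [j]"] by simp
qed

lemma smooth_differentiable: "smooth f \<Longrightarrow> f differentiable (at x)"
  unfolding smooth_def by (drule spec[of _ "[]"]) (simp add: differentiable_on_def)

lemma smooth_continuous: "smooth f \<Longrightarrow> continuous_on UNIV f"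
  unfolding smooth_def by (drule spec[of _ "[]"]) (simp add: differentiable_imp_continuous_on)

lemma smooth_has_vector_derivative:
  assumes "smooth f"
  shows "((\<lambda>t. f (x + t *\<^sub>R axis j 1)) has_vector_derivative pd j f x) (at 0)"
proof -
  have line: "((\<lambda>t. x + t *\<^sub>R axis j 1) has_derivative (\<lambda>t. t *\<^sub>R axis j 1)) (at 0)"
    by (auto intro!: derivative_eq_intros)
  have "(f has_derivative frechet_derivative f (at x)) (at (x + 0 *\<^sub>R axis j 1))"
    using smooth_differentiable[OF assms, of x] frechet_derivative_works[of f "at x"] by simp
  from diff_chain_at[OF line this]
  have "((\<lambda>t. f (x + t *\<^sub>R axis j 1)) has_derivative
      (\<lambda>t. frechet_derivative f (at x) (t *\<^sub>R axis j 1))) (at 0)"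
    by (simp add: o_def)
  moreover have "linear (frechet_derivative f (at x))"
    using smooth_differentiable[OF assms] by (rule linear_frechet_derivative)
  ultimately show ?thesis
    by (simp add: has_vector_derivative_def pd_def linear_cmul)
qed

lemma smooth_has_pd: "smooth f \<Longrightarrow> has_pd j f (pd j f x) x"
  unfolding has_pd_def has_real_derivative_iff_has_vector_derivative
  by (rule smooth_has_vector_derivative)

lemma smooth_has_pd_Re: "smooth f \<Longrightarrow> has_pd j (\<lambda>x. Re (f x)) (Re (pd j f x)) x"
  unfolding has_pd_def has_real_derivative_iff_has_vector_derivative
  by (rule bounded_linear.has_vector_derivative[OF bounded_linear_Re smooth_has_vector_derivative])

lemma smooth_has_pd_Im: "smooth f \<Longrightarrow> has_pd j (\<lambda>x. Im (f x)) (Im (pd j f x)) x"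
  unfolding has_pd_def has_real_derivative_iff_has_vector_derivative
  by (rule bounded_linear.has_vector_derivative[OF bounded_linear_Im smooth_has_vector_derivative])

lemma smooth_twice_pd: "smooth f \<Longrightarrow> twice_pd S f (\<lambda>j. pd j f) (\<lambda>j. pd j (pd j f))"
  by (simp add: twice_pd_def smooth_has_pd smooth_pd)

lemma has_pd_mvt:
  assumes "\<And>x. has_pd j F (G x) x" "h > 0"
  obtains s where "0 < s" "s < h" "F (x + h *\<^sub>R axis j 1) - F x = h * G (x + s *\<^sub>R axis j 1)"
proof -
  have "\<exists>s. s > 0 \<and> s < h \<and> F (x + h *\<^sub>R axis j 1) - F (x + 0 *\<^sub>R axis j 1) = (h - 0) * G (x + s *\<^sub>R axis j 1)"
    by (rule MVT2[OF assms(2)]) (simp add: has_pd_line[symmetric] assms(1))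
  then show ?thesis using that by auto
qed

text \<open>Schwarz's theorem: both mixed derivatives are limits of the same second difference.\<close>

lemma second_difference:
  assumes F: "\<And>x. has_pd j F (F1 x) x" and F1: "\<And>x. has_pd k F1 (F2 x) x" and h: "h > 0"
  obtains y where "norm (y - x) \<le> 2 * h"
    "F (x + h *\<^sub>R axis j 1 + h *\<^sub>R axis k 1) - F (x + h *\<^sub>R axis j 1) - F (x + h *\<^sub>R axis k 1) + F x = h\<^sup>2 * F2 y"
proof -
  let ?D = "\<lambda>x. F (x + h *\<^sub>R axis k 1) - F x"
  have "has_pd j (\<lambda>x. F (x + h *\<^sub>R axis k 1)) (F1 (x + h *\<^sub>R axis k 1)) x" for x
    using F[of "x + h *\<^sub>R axis k 1"] unfolding has_pd_def by (simp add: add_ac)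
  then have "has_pd j ?D (F1 (x + h *\<^sub>R axis k 1) - F1 x) x" for x
    by (intro has_pd_diff F)
  from has_pd_mvt[OF this h, of x] obtain s where s: "0 < s" "s < h"
    "?D (x + h *\<^sub>R axis j 1) - ?D x = h * (F1 (x + s *\<^sub>R axis j 1 + h *\<^sub>R axis k 1) - F1 (x + s *\<^sub>R axis j 1))"
    by metis
  from has_pd_mvt[OF F1 h, of "x + s *\<^sub>R axis j 1"] obtain t where t: "0 < t" "t < h"
    "F1 (x + s *\<^sub>R axis j 1 + h *\<^sub>R axis k 1) - F1 (x + s *\<^sub>R axis j 1)
      = h * F2 (x + s *\<^sub>R axis j 1 + t *\<^sub>R axis k 1)"
    by metis
  show ?thesis
  proof (rule that)
    show "norm (x + s *\<^sub>R axis j 1 + t *\<^sub>R axis k 1 - x) \<le> 2 * h"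
      using s t norm_triangle_ineq[of "s *\<^sub>R axis j (1::real) :: real ^ 2" "t *\<^sub>R axis k 1"] by simp
    show "F (x + h *\<^sub>R axis j 1 + h *\<^sub>R axis k 1) - F (x + h *\<^sub>R axis j 1) - F (x + h *\<^sub>R axis k 1) + F x
        = h\<^sup>2 * F2 (x + s *\<^sub>R axis j 1 + t *\<^sub>R axis k 1)"
      using s(3) t(3) by (simp add: power2_eq_square)
  qed
qed

text \<open>The second difference over a square of side \<open>h\<close> is \<open>h^2\<close> times
  a value of \<open>A\<close> and also \<open>h^2\<close> times a value of \<open>B\<close>, both
  taken within \<open>2 * h\<close> of \<open>x\<close>. For small \<open>h\<close> each is within
  half the gap of its value at \<open>x\<close>, so the gap is zero.\<close>

lemma mixed_pd_eq:
  assumes F: "\<And>j x. has_pd j F (G j x) x"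
    and jk: "\<And>x. has_pd k (G j) (A x) x" and kj: "\<And>x. has_pd j (G k) (B x) x"
    and cont: "isCont A x" "isCont B x"
  shows "A x = B x"
proof (rule ccontr)
  assume "A x \<noteq> B x"
  define e where "e = \<bar>A x - B x\<bar> / 2"
  have e: "e > 0" using \<open>A x \<noteq> B x\<close> by (simp add: e_def)
  obtain d1 where d1: "d1 > 0" "\<And>y. dist y x < d1 \<Longrightarrow> dist (A y) (A x) < e"
    using cont(1) e unfolding continuous_at_eps_delta by blast
  obtain d2 where d2: "d2 > 0" "\<And>y. dist y x < d2 \<Longrightarrow> dist (B y) (B x) < e"
    using cont(2) e unfolding continuous_at_eps_delta by blast
  define h where "h = min d1 d2 / 3"
  have h: "h > 0" "2 * h < d1" "2 * h < d2" using d1(1) d2(1) by (auto simp: h_def min_def)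
  obtain y where y: "norm (y - x) \<le> 2 * h"
    "F (x + h *\<^sub>R axis j 1 + h *\<^sub>R axis k 1) - F (x + h *\<^sub>R axis j 1) - F (x + h *\<^sub>R axis k 1) + F x = h\<^sup>2 * A y"
    by (rule second_difference[OF F jk h(1)])
  obtain w where w: "norm (w - x) \<le> 2 * h"
    "F (x + h *\<^sub>R axis k 1 + h *\<^sub>R axis j 1) - F (x + h *\<^sub>R axis k 1) - F (x + h *\<^sub>R axis j 1) + F x = h\<^sup>2 * B w"
    by (rule second_difference[OF F kj h(1)])
  have comm: "x + h *\<^sub>R axis k 1 + h *\<^sub>R axis j 1 = x + h *\<^sub>R axis j 1 + h *\<^sub>R axis k 1"
    by (simp add: add_ac)
  have "h\<^sup>2 * A y = h\<^sup>2 * B w" using y(2) w(2)[unfolded comm] by linarith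
  then have "A y = B w" using h by simp
  moreover have "dist (A y) (A x) < e" "dist (B w) (B x) < e"
    using y(1) w(1) h d1(2)[of y] d2(2)[of w] by (auto simp: dist_norm)
  ultimately show False unfolding e_def dist_real_def by argo
qed

text \<open>The mean value theorem behind the second difference is for real functions, hence the
  split into real and imaginary parts.\<close>

lemma smooth_mixed_pd:
  fixes f :: "real ^ 2 \<Rightarrow> complex"
  assumes "smooth f"
  shows "pd j (pd k f) x = pd k (pd j f) x"
proof (rule complex_eqI)
  have c: "isCont (pd j (pd k f)) x" "isCont (pd k (pd j f)) x"
    using smooth_continuous[OF smooth_pd[OF smooth_pd[OF assms]]]
    by (auto simp: continuous_on_eq_continuous_at)
  show "Re (pd j (pd k f) x) = Re (pd k (pd j f) x)"
    by (rule mixed_pd_eq[where F = "\<lambda>x. Re (f x)" and G = "\<lambda>j x. Re (pd j f x)" and j = k and k = j])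
      (intro smooth_has_pd_Re smooth_pd assms isCont_Re c)+
  show "Im (pd j (pd k f) x) = Im (pd k (pd j f) x)"
    by (rule mixed_pd_eq[where F = "\<lambda>x. Im (f x)" and G = "\<lambda>j x. Im (pd j f x)" and j = k and k = j])
      (intro smooth_has_pd_Im smooth_pd assms isCont_Im c)+
qed

section \<open>The logarithm of the modulus of a self-dual field\<close>

lemma has_pd_ln_cmod_sq:
  assumes "smooth \<phi>" "\<phi> x \<noteq> 0"
  shows "has_pd j (\<lambda>x. ln ((cmod (\<phi> x))\<^sup>2))
    (2 * (Re (\<phi> x) * Re (pd j \<phi> x) + Im (\<phi> x) * Im (pd j \<phi> x)) / (cmod (\<phi> x))\<^sup>2) x"
proof -
  have "has_pd j (\<lambda>x. (cmod (\<phi> x))\<^sup>2) (2 * (Re (\<phi> x) * Re (pd j \<phi> x) + Im (\<phi> x) * Im (pd j \<phi> x))) x"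
    unfolding cmod_power2
    by (rule has_pd_eq[OF has_pd_add[OF has_pd_power[OF smooth_has_pd_Re[OF assms(1)]]
        has_pd_power[OF smooth_has_pd_Im[OF assms(1)]]]]) simp
  then show ?thesis
    using assms(2) by (intro has_pd_eq[OF has_pd_chain[OF _ DERIV_ln]]) (auto simp: field_simps)
qed

text \<open>With \<theta> the local phase of phi, the quotients are derivatives of \<theta>: the two
  components are 2 (d_2 \<theta> - q A_2) and - 2 (d_1 \<theta> - q A_1). No choice of \<theta> is
  made, so the formula makes sense wherever phi is nonzero.\<close>

definition log_pd ::
  "real \<Rightarrow> (nat \<Rightarrow> real ^ 2 \<Rightarrow> real) \<Rightarrow> (real ^ 2 \<Rightarrow> complex) \<Rightarrow> 2 \<Rightarrow> real ^ 2 \<Rightarrow> real" where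
  "log_pd q A \<phi> j x =
     (if j = 1
      then 2 * ((Re (\<phi> x) * Im (pd 2 \<phi> x) - Im (\<phi> x) * Re (pd 2 \<phi> x)) / (cmod (\<phi> x))\<^sup>2 - q * A 2 x)
      else 2 * ((Im (\<phi> x) * Re (pd 1 \<phi> x) - Re (\<phi> x) * Im (pd 1 \<phi> x)) / (cmod (\<phi> x))\<^sup>2 + q * A 1 x))"

lemma self_dual_Re_Im:
  assumes "cov_deriv q A 1 \<phi> x + \<i> * cov_deriv q A 2 \<phi> x = 0"
  shows "Re (pd 1 \<phi> x) + q * A 1 x * Im (\<phi> x) - Im (pd 2 \<phi> x) + q * A 2 x * Re (\<phi> x) = 0"
    and "Im (pd 1 \<phi> x) - q * A 1 x * Re (\<phi> x) + Re (pd 2 \<phi> x) + q * A 2 x * Im (\<phi> x) = 0"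
  using arg_cong[OF assms, of Re] arg_cong[OF assms, of Im]
  by (simp_all add: cov_deriv_def spacetime_pd_def algebra_simps)

text \<open>The plain derivative 2 Re (conj phi d_j phi) / |phi|^2 involves d_j phi; the real and
  imaginary parts of the self-duality equation trade it for the derivative along the other axis and
  the potential.\<close>

lemma has_pd_ln_self_dual:
  assumes "smooth \<phi>" "\<phi> x \<noteq> 0" and sd: "cov_deriv q A 1 \<phi> x + \<i> * cov_deriv q A 2 \<phi> x = 0"
  shows "has_pd j (\<lambda>x. ln ((cmod (\<phi> x))\<^sup>2)) (log_pd q A \<phi> j x) x"
proof (rule has_pd_eq[OF has_pd_ln_cmod_sq[OF assms(1,2)]])
  define a b where "a = Re (\<phi> x)" and "b = Im (\<phi> x)"
  note E = self_dual_Re_Im[OF sd, folded a_def b_def]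
  have P: "(cmod (\<phi> x))\<^sup>2 = a\<^sup>2 + b\<^sup>2" by (simp add: a_def b_def cmod_power2)
  have P0: "a\<^sup>2 + b\<^sup>2 \<noteq> 0" using assms(2) P by (metis norm_eq_zero power_eq_0_iff)
  have 1: "a * Re (pd 1 \<phi> x) + b * Im (pd 1 \<phi> x)
      = (a * Im (pd 2 \<phi> x) - b * Re (pd 2 \<phi> x)) - q * A 2 x * (a\<^sup>2 + b\<^sup>2)"
    using E by algebra
  have 2: "a * Re (pd 2 \<phi> x) + b * Im (pd 2 \<phi> x)
      = (b * Re (pd 1 \<phi> x) - a * Im (pd 1 \<phi> x)) + q * A 1 x * (a\<^sup>2 + b\<^sup>2)"
    using E by algebra
  have div: "2 * (u - q * c * p) / p = 2 * (u / p - q * c)" "2 * (u + q * c * p) / p = 2 * (u / p + q * c)"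
    if "p \<noteq> 0" for u c p using that by (simp_all add: diff_divide_distrib add_divide_distrib)
  show "2 * (Re (\<phi> x) * Re (pd j \<phi> x) + Im (\<phi> x) * Im (pd j \<phi> x)) / (cmod (\<phi> x))\<^sup>2 = log_pd q A \<phi> j x"
  proof (cases "j = 1")
    case True
    then show ?thesis
      unfolding log_pd_def P a_def[symmetric] b_def[symmetric] if_P[OF True] True 1 div(1)[OF P0]
      by simp
  next
    case False
    then have "j = 2" using exhaust_2 by metis
    then show ?thesis
      unfolding log_pd_def P a_def[symmetric] b_def[symmetric] \<open>j = 2\<close> 2 div(2)[OF P0]
      by simp
  qed
qed

text \<open>The first derivatives of \<open>ln |\<phi>|\<^sup>2\<close> are those of the phase rotated by a right angle, up to the
  potential, so the phase drops out of the Laplacian and only the magnetic field remains.\<close>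

lemma laplacian_ln_self_dual:
  assumes \<phi>: "smooth \<phi>" and A: "smooth (A 1)" "smooth (A 2)"
    and sd: "\<And>x. cov_deriv q A 1 \<phi> x + \<i> * cov_deriv q A 2 \<phi> x = 0"
  obtains H where "twice_pd {x. \<phi> x \<noteq> 0} (\<lambda>x. ln ((cmod (\<phi> x))\<^sup>2)) (log_pd q A \<phi>) H"
    "\<And>x. \<phi> x \<noteq> 0 \<Longrightarrow> H 1 x + H 2 x = - 2 * q * F12 A x"
proof -
  define a b where "a = (\<lambda>x. Re (\<phi> x))" and "b = (\<lambda>x. Im (\<phi> x))"
  define a1 a2 b1 b2 where "a1 = (\<lambda>x. Re (pd 1 \<phi> x))" and "a2 = (\<lambda>x. Re (pd 2 \<phi> x))"
    and "b1 = (\<lambda>x. Im (pd 1 \<phi> x))" and "b2 = (\<lambda>x. Im (pd 2 \<phi> x))"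
  \<comment> \<open>In the rotated form only mixed second derivatives of phi occur, and by symmetry
    one name serves both orders.\<close>
  define a12 b12 where "a12 = (\<lambda>x. Re (pd 1 (pd 2 \<phi>) x))" and "b12 = (\<lambda>x. Im (pd 1 (pd 2 \<phi>) x))"
  have ders: "has_pd 1 a (a1 x) x" "has_pd 2 a (a2 x) x" "has_pd 1 b (b1 x) x" "has_pd 2 b (b2 x) x"
    "has_pd 1 a2 (a12 x) x" "has_pd 2 a1 (a12 x) x" "has_pd 1 b2 (b12 x) x" "has_pd 2 b1 (b12 x) x" for x
    unfolding a_def b_def a1_def a2_def b1_def b2_def a12_def b12_def
    by (intro smooth_has_pd_Re smooth_has_pd_Im smooth_pd \<phi>
        smooth_has_pd_Re[OF smooth_pd[OF \<phi>], of 2 1, unfolded smooth_mixed_pd[OF \<phi>, of 2 1]]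
        smooth_has_pd_Im[OF smooth_pd[OF \<phi>], of 2 1, unfolded smooth_mixed_pd[OF \<phi>, of 2 1]])+
  define P where "P = (\<lambda>x. a x ^ 2 + b x ^ 2)"
  have P: "(cmod (\<phi> x))\<^sup>2 = P x" for x by (simp add: P_def a_def b_def cmod_power2)
  have P1: "has_pd 1 P (2 * (a x * a1 x + b x * b1 x)) x" for x
    unfolding P_def by (rule has_pd_eq[OF has_pd_add[OF has_pd_power[OF ders(1)] has_pd_power[OF ders(3)]]]) simp
  have P2: "has_pd 2 P (2 * (a x * a2 x + b x * b2 x)) x" for x
    unfolding P_def by (rule has_pd_eq[OF has_pd_add[OF has_pd_power[OF ders(2)] has_pd_power[OF ders(4)]]]) simp
  define X where "X = (\<lambda>x. a1 x * b2 x + a x * b12 x - (b1 x * a2 x + b x * a12 x))"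
  define Y where "Y = (\<lambda>x. b2 x * a1 x + b x * a12 x - (a2 x * b1 x + a x * b12 x))"
  define H where "H = (\<lambda>j x. if j = (1::2)
    then 2 * ((X x * P x - (a x * b2 x - b x * a2 x) * (2 * (a x * a1 x + b x * b1 x))) / (P x * P x) - q * pd 1 (A 2) x)
    else 2 * ((Y x * P x - (b x * a1 x - a x * b1 x) * (2 * (a x * a2 x + b x * b2 x))) / (P x * P x) + q * pd 2 (A 1) x))"
  show ?thesis
  proof (rule that)
    show "twice_pd {x. \<phi> x \<noteq> 0} (\<lambda>x. ln ((cmod (\<phi> x))\<^sup>2)) (log_pd q A \<phi>) H"
      unfolding twice_pd_def
    proof safe
      fix x j assume x: "\<phi> x \<noteq> 0"
      then show "has_pd j (\<lambda>x. ln ((cmod (\<phi> x))\<^sup>2)) (log_pd q A \<phi> j x) x"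
        by (intro has_pd_ln_self_dual \<phi> sd)
      have P0: "P x \<noteq> 0" using x P[of x] by (metis norm_eq_zero power_eq_0_iff)
      show "has_pd j (log_pd q A \<phi> j) (H j x) x"
      proof (cases "j = 1")
        case True
        have "log_pd q A \<phi> j = (\<lambda>x. 2 * ((a x * b2 x - b x * a2 x) / P x - q * A 2 x))"
          unfolding log_pd_def P fun_eq_iff using True by (simp add: a_def b_def a2_def b2_def)
        moreover have "H j x = 2 * ((X x * P x - (a x * b2 x - b x * a2 x) * (2 * (a x * a1 x + b x * b1 x))) / (P x * P x) - q * pd 1 (A 2) x)"
          using True by (simp add: H_def)
        moreover have "has_pd 1 (\<lambda>x. a x * b2 x - b x * a2 x) (X x) x"
          unfolding X_def by (intro has_pd_diff has_pd_mult ders)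
        ultimately show ?thesis
          unfolding True using P0 by (simp only:) (intro has_pd_cmult has_pd_diff has_pd_divide P1 smooth_has_pd A; simp)
      next
        case False
        then have j: "j = 2" using exhaust_2 by metis
        have "log_pd q A \<phi> j = (\<lambda>x. 2 * ((b x * a1 x - a x * b1 x) / P x + q * A 1 x))"
          unfolding log_pd_def P fun_eq_iff using False by (simp add: a_def b_def a1_def b1_def)
        moreover have "H j x = 2 * ((Y x * P x - (b x * a1 x - a x * b1 x) * (2 * (a x * a2 x + b x * b2 x))) / (P x * P x) + q * pd 2 (A 1) x)"
          using False by (simp add: H_def)
        moreover have "has_pd 2 (\<lambda>x. b x * a1 x - a x * b1 x) (Y x) x"
          unfolding Y_def by (intro has_pd_diff has_pd_mult ders)
        ultimately show ?thesis
          unfolding j using P0 by (simp only:) (intro has_pd_cmult has_pd_add has_pd_divide P2 smooth_has_pd A; simp)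
      qed
    qed
    fix x assume "\<phi> x \<noteq> 0"
    then have P0: "P x \<noteq> 0" using P[of x] by (metis norm_eq_zero power_eq_0_iff)
    \<comment> \<open>These are the numerators of d_1 d_2 \<theta> and - d_2 d_1 \<theta>; their
      cancellation is what removes the phase.\<close>
    define n1 where "n1 = X x * P x - (a x * b2 x - b x * a2 x) * (2 * (a x * a1 x + b x * b1 x))"
    define n2 where "n2 = Y x * P x - (b x * a1 x - a x * b1 x) * (2 * (a x * a2 x + b x * b2 x))"
    have "n1 + n2 = 0"
      unfolding n1_def n2_def X_def Y_def P_def by (simp add: algebra_simps power2_eq_square)
    then have n2: "n2 = - n1" by simp
    have "H 1 x = 2 * (n1 / (P x * P x) - q * pd 1 (A 2) x)"
      by (simp add: H_def n1_def)
    moreover have "H 2 x = 2 * (n2 / (P x * P x) + q * pd 2 (A 1) x)"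
      by (simp add: H_def n2_def)
    ultimately have "H 1 x + H 2 x = - 2 * q * (pd 1 (A 2) x - pd 2 (A 1) x)"
      unfolding n2 by (simp add: algebra_simps)
    then show "H 1 x + H 2 x = - 2 * q * F12 A x"
      by (simp add: F12_def)
  qed
qed

text \<open>Self-duality gives |D_1 phi| = |D_2 phi|, and 4 |D_1 phi|^2 is |phi|^2 times the squared
  length of the gradient of ln |phi|^2; the factor |phi|^2 is at most 1.\<close>

lemma cov_deriv_bound:
  assumes "smooth \<phi>" "\<phi> x \<noteq> 0" "cmod (\<phi> x) \<le> 1" "cov_deriv q A 1 \<phi> x + \<i> * cov_deriv q A 2 \<phi> x = 0"
    and \<mu>: "\<mu> = 1 \<or> \<mu> = 2"
  shows "cmod (cov_deriv q A \<mu> \<phi> x) \<le> \<bar>log_pd q A \<phi> 1 x\<bar> + \<bar>log_pd q A \<phi> 2 x\<bar>"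
proof -
  let ?D = "cov_deriv q A 1 \<phi> x"
  have "?D = - (\<i> * cov_deriv q A 2 \<phi> x)" using assms(4) by (simp add: eq_neg_iff_add_eq_0)
  then have "cmod (cov_deriv q A \<mu> \<phi> x) = cmod ?D" using \<mu> by (auto simp: norm_mult)
  also have "\<dots> \<le> \<bar>log_pd q A \<phi> 1 x\<bar> + \<bar>log_pd q A \<phi> 2 x\<bar>"
  proof -
    define a b where "a = Re (\<phi> x)" and "b = Im (\<phi> x)"
    define P where "P = (cmod (\<phi> x))\<^sup>2"
    have P: "P = a\<^sup>2 + b\<^sup>2" by (simp add: P_def a_def b_def cmod_power2)
    have P0: "P > 0" using assms(2) by (simp add: P_def)
    have P1: "P \<le> 1" using assms(3) power_mono[of "cmod (\<phi> x)" 1 2] by (simp add: P_def)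
    define c d where "c = Re (pd 1 \<phi> x)" and "d = Im (pd 1 \<phi> x)"
    have e: "?D = Complex (c + q * A 1 x * b) (d - q * A 1 x * a)"
      by (simp add: complex_eq_iff cov_deriv_def spacetime_pd_def a_def b_def c_def d_def)
    have D: "(cmod ?D)\<^sup>2 = (c + q * A 1 x * b)\<^sup>2 + (d - q * A 1 x * a)\<^sup>2"
      unfolding e cmod_power2 by simp
    \<comment> \<open>By definition this component is written with d_2 phi, whereas D_1 phi contains
      d_1 phi. Uniqueness of derivatives restores the unrotated formula, so that both components are
      expressed through d_1 phi.\<close>
    have "log_pd q A \<phi> 1 x = 2 * (a * c + b * d) / P"
      using has_pd_ln_cmod_sq[OF assms(1,2), of 1] has_pd_ln_self_dual[OF assms(1,2,4), of 1]
      unfolding has_pd_def a_def b_def c_def d_def P_def by (rule DERIV_unique[symmetric])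
    then have l1: "log_pd q A \<phi> 1 x * P = 2 * (a * c + b * d)" using P0 by simp
    have "log_pd q A \<phi> 2 x = 2 * ((b * c - a * d) / P + q * A 1 x)"
      by (simp add: log_pd_def a_def b_def c_def d_def P_def)
    then have l2: "log_pd q A \<phi> 2 x * P = 2 * (b * c - a * d + q * A 1 x * P)"
      using P0 by (simp add: field_simps)
    let ?u = "log_pd q A \<phi> 1 x" and ?v = "log_pd q A \<phi> 2 x"
    have "4 * (cmod ?D)\<^sup>2 * P = (2 * (a * c + b * d))\<^sup>2 + (2 * (b * c - a * d + q * A 1 x * P))\<^sup>2"
      unfolding D P by (simp add: algebra_simps power2_eq_square)
    also have "\<dots> = (?u * P)\<^sup>2 + (?v * P)\<^sup>2" unfolding l1 l2 ..
    also have "\<dots> = P * (P * (?u\<^sup>2 + ?v\<^sup>2))" by (simp add: algebra_simps power2_eq_square)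
    finally have "4 * (cmod ?D)\<^sup>2 = P * (?u\<^sup>2 + ?v\<^sup>2)" using P0 by simp
    also have "\<dots> \<le> 1 * (?u\<^sup>2 + ?v\<^sup>2)" using P1 by (intro mult_right_mono) auto
    also have "\<dots> \<le> (\<bar>?u\<bar> + \<bar>?v\<bar>)\<^sup>2" by (simp add: power2_sum)
    finally have "(cmod ?D)\<^sup>2 \<le> (\<bar>?u\<bar> + \<bar>?v\<bar>)\<^sup>2" by (smt (verit) zero_le_power2)
    then show ?thesis by (rule power2_le_imp_le) simp
  qed
  finally show ?thesis .
qed

section \<open>Vortex functions\<close>

lemma twice_pd_cong_open:
  assumes "twice_pd S F G H" "open S" "\<And>x. x \<in> S \<Longrightarrow> F x = F' x"
  shows "twice_pd S F' G H"
  using assms has_pd_cong_open[OF _ assms(2)] unfolding twice_pd_def by blast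

lemma twice_pd_sum:
  "(\<And>i. i \<in> I \<Longrightarrow> twice_pd S (F i) (G i) (H i)) \<Longrightarrow>
    twice_pd S (\<lambda>x. \<Sum>i\<in>I. F i x) (\<lambda>j x. \<Sum>i\<in>I. G i j x) (\<lambda>j x. \<Sum>i\<in>I. H i j x)"
  by (simp add: twice_pd_def has_pd_sum)

text \<open>In the plane ln |x - a|^2 is harmonic off \<open>a\<close>, so the result is minus the
  Laplacian of ln (1 + |x - a|^2). This is the origin of \<open>vortex_g\<close>.\<close>

lemma laplacian_log_ratio:
  obtains G H where "twice_pd (- {a}) (\<lambda>x. ln ((norm (x - a))\<^sup>2 / (1 + (norm (x - a))\<^sup>2))) G H"
    "\<And>x. x \<noteq> a \<Longrightarrow> H 1 x + H 2 x = - 4 / (1 + (norm (x - a))\<^sup>2)\<^sup>2"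
proof
  let ?s = "\<lambda>x. (norm (x - a))\<^sup>2"
  let ?H = "\<lambda>j x. (2 * (?s x * (1 + ?s x)) - 2 * (x $ j - a $ j) * (2 * (x $ j - a $ j) * (1 + 2 * ?s x)))
        / ((?s x * (1 + ?s x)) * (?s x * (1 + ?s x)))"
  show "twice_pd (- {a}) (\<lambda>x. ln (?s x / (1 + ?s x)))
     (\<lambda>j x. 2 * (x $ j - a $ j) / (?s x * (1 + ?s x))) ?H"
    unfolding twice_pd_def
  proof safe
    fix x j assume "x \<noteq> a"
    then have s: "?s x > 0" by simp
    have "((\<lambda>s. ln (s / (1 + s))) has_real_derivative 1 / (t * (1 + t))) (at t)" if "t > 0" for t :: real
    proof (rule DERIV_cong)
      show "((\<lambda>s. ln (s / (1 + s))) has_real_derivative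
          inverse (t / (1 + t)) * ((1 * (1 + t) - t * 1) / ((1 + t) * (1 + t)))) (at t)"
        using that by (intro DERIV_chain2[OF DERIV_ln]) (auto intro!: derivative_eq_intros)
      show "inverse (t / (1 + t)) * ((1 * (1 + t) - t * 1) / ((1 + t) * (1 + t))) = 1 / (t * (1 + t))"
        using that by (simp add: divide_simps)
    qed
    from has_pd_chain[OF has_pd_dist_sq this[OF s]]
    show "has_pd j (\<lambda>x. ln (?s x / (1 + ?s x))) (2 * (x $ j - a $ j) / (?s x * (1 + ?s x))) x"
      by simp
    have num: "has_pd j (\<lambda>x. 2 * (x $ j - a $ j)) 2 x"
      by (rule has_pd_eq[OF has_pd_cmult[OF has_pd_diff[OF has_pd_coord has_pd_const]]]) simp
    have den: "has_pd j (\<lambda>x. ?s x * (1 + ?s x)) (2 * (x $ j - a $ j) * (1 + 2 * ?s x)) x"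
      by (rule has_pd_eq[OF has_pd_mult[OF has_pd_dist_sq has_pd_add[OF has_pd_const has_pd_dist_sq]]])
        (simp add: algebra_simps)
    show "has_pd j (\<lambda>x. 2 * (x $ j - a $ j) / (?s x * (1 + ?s x))) (?H j x) x"
    proof (intro has_pd_divide[OF num den])
      have "?s x * (1 + ?s x) > 0" using s by (intro mult_pos_pos) linarith+
      then show "?s x * (1 + ?s x) \<noteq> 0" by linarith
    qed
  qed
  fix x assume "x \<noteq> a"
  define s c1 c2 where "s = ?s x" and "c1 = x $ 1 - a $ 1" and "c2 = x $ 2 - a $ 2"
  have s: "s > 0" and sc: "c1\<^sup>2 + c2\<^sup>2 = s"
    using \<open>x \<noteq> a\<close> sum_sq_coords[of x a] by (auto simp: s_def c1_def c2_def)
  have "?H 1 x + ?H 2 x = (4 * (s * (1 + s)) - 4 * (1 + 2 * s) * (c1\<^sup>2 + c2\<^sup>2)) / ((s * (1 + s)) * (s * (1 + s)))"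
    unfolding s_def[symmetric] c1_def[symmetric] c2_def[symmetric] add_divide_distrib[symmetric]
    by (simp add: algebra_simps power2_eq_square)
  also have "4 * (s * (1 + s)) - 4 * (1 + 2 * s) * (c1\<^sup>2 + c2\<^sup>2) = - 4 * (s * s)"
    unfolding sc by (simp add: algebra_simps)
  also have "- 4 * (s * s) / ((s * (1 + s)) * (s * (1 + s))) = - 4 / (1 + s)\<^sup>2"
    using s by (simp add: divide_simps power2_eq_square)
  finally show "?H 1 x + ?H 2 x = - 4 / (1 + ?s x)\<^sup>2" unfolding s_def .
qed

lemma laplacian_vortex_f:
  obtains G H where "twice_pd (- z ` {1..m}) (vortex_f m z n) G H"
    "\<And>x. x \<notin> z ` {1..m} \<Longrightarrow> H 1 x + H 2 x = - vortex_g m z n x"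
proof -
  \<comment> \<open>Both properties are packed into one predicate so that a single choice over all
    centres yields matching families \<open>G\<close> and \<open>H\<close>.\<close>
  define Q where "Q = (\<lambda>(a :: real ^ 2) G H.
      twice_pd (- {a}) (\<lambda>x. ln ((norm (x - a))\<^sup>2 / (1 + (norm (x - a))\<^sup>2))) G H \<and>
      (\<forall>x. x \<noteq> a \<longrightarrow> H 1 x + H 2 x = - 4 / (1 + (norm (x - a))\<^sup>2)\<^sup>2))"
  have "\<exists>G H. Q a G H" for a
    unfolding Q_def by (rule laplacian_log_ratio[of a]) blast
  then obtain G H where "\<And>a. Q a (G a) (H a)"
    by metis
  then have GH: "\<And>a :: real ^ 2. twice_pd (- {a}) (\<lambda>x. ln ((norm (x - a))\<^sup>2 / (1 + (norm (x - a))\<^sup>2))) (G a) (H a)"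
    and lap: "\<And>a x :: real ^ 2. x \<noteq> a \<Longrightarrow> H a 1 x + H a 2 x = - 4 / (1 + (norm (x - a))\<^sup>2)\<^sup>2"
    unfolding Q_def by blast+
  show ?thesis
  proof (rule that)
    show "twice_pd (- z ` {1..m}) (vortex_f m z n)
        (\<lambda>j x. \<Sum>i = 1..m. real (n i) * G (z i) j x) (\<lambda>j x. \<Sum>i = 1..m. real (n i) * H (z i) j x)"
      unfolding vortex_f_def
      by (intro twice_pd_sum twice_pd_cmult twice_pd_subset[OF GH]) auto
    fix x assume x: "x \<notin> z ` {1..m}"
    have "(\<Sum>i = 1..m. real (n i) * H (z i) 1 x) + (\<Sum>i = 1..m. real (n i) * H (z i) 2 x)
        = (\<Sum>i = 1..m. real (n i) * (H (z i) 1 x + H (z i) 2 x))"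
      by (simp add: sum.distrib algebra_simps)
    also have "\<dots> = (\<Sum>i = 1..m. real (n i) * (- 4 / (1 + (norm (x - z i))\<^sup>2)\<^sup>2))"
      using x by (intro sum.cong refl arg_cong2[where f = times] lap) auto
    also have "\<dots> = - vortex_g m z n x"
      by (simp add: vortex_g_def sum_negf[symmetric] mult.commute)
    finally show "(\<Sum>i = 1..m. real (n i) * H (z i) 1 x) + (\<Sum>i = 1..m. real (n i) * H (z i) 2 x)
        = - vortex_g m z n x" .
  qed
qed

text \<open>The product is one formula for both cases of \<open>exp_vf\<close>: at a vortex its
  factor vanishes because the multiplicity is positive. Continuity across the vortices is read off
  from it.\<close>

lemma exp_vf_prod:
  assumes "\<And>j. j \<in> {1..m} \<Longrightarrow> n j > 0"
  shows "exp_vf m z n v x = exp (v x) * (\<Prod>j = 1..m. ((norm (x - z j))\<^sup>2 / (1 + (norm (x - z j))\<^sup>2)) ^ n j)"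
proof (cases "x \<in> z ` {1..m}")
  case True
  then obtain j where j: "j \<in> {1..m}" "x = z j" by auto
  then have "((norm (x - z j))\<^sup>2 / (1 + (norm (x - z j))\<^sup>2)) ^ n j = 0"
    using assms by simp
  then have "(\<Prod>j = 1..m. ((norm (x - z j))\<^sup>2 / (1 + (norm (x - z j))\<^sup>2)) ^ n j) = 0"
    using j(1) by (intro prod_zero) auto
  then show ?thesis using True by (simp add: exp_vf_def)
next
  case False
  have "exp (real (n j) * ln ((norm (x - z j))\<^sup>2 / (1 + (norm (x - z j))\<^sup>2)))
      = ((norm (x - z j))\<^sup>2 / (1 + (norm (x - z j))\<^sup>2)) ^ n j" if "j \<in> {1..m}" for j
  proof -
    have "(norm (x - z j))\<^sup>2 / (1 + (norm (x - z j))\<^sup>2) > 0"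
      using False that by (intro divide_pos_pos add_pos_nonneg) auto
    then show ?thesis by (simp add: exp_of_nat_mult)
  qed
  then show ?thesis
    using False by (simp add: exp_vf_def exp_add vortex_f_def exp_sum)
qed

lemma continuous_exp_vf:
  assumes "\<And>j. j \<in> {1..m} \<Longrightarrow> n j > 0" "continuous_on UNIV v"
  shows "continuous_on UNIV (exp_vf m z n v)"
proof -
  have "1 + t\<^sup>2 \<noteq> 0" for t :: real
    using zero_le_power2[of t] by linarith
  moreover have "exp_vf m z n v =
      (\<lambda>x. exp (v x) * (\<Prod>j = 1..m. ((norm (x - z j))\<^sup>2 / (1 + (norm (x - z j))\<^sup>2)) ^ n j))"
    by (intro ext exp_vf_prod assms(1))
  ultimately show ?thesis
    by (simp only:) (intro continuous_intros assms(2); simp)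
qed

text \<open>\<open>vortex_g\<close> cancels against the Laplacian of \<open>vortex_f\<close>,
  leaving exactly the equation treated by \<open>Keller_Osserman\<close>; the vortices carry the
  value 0 and so lie outside the region where the exponential exceeds 1. The barrier suits the
  situation because \<open>smooth_H2\<close> speaks of integrals and not of limits at
  infinity.\<close>

lemma abelian_higgs_exp_vf_le_1:
  assumes "q > 0" and n: "\<And>j. j \<in> {1..m} \<Longrightarrow> n j > 0" and w: "abelian_higgs q m z n w"
  shows "exp_vf m z n w x \<le> 1"
proof -
  have sw: "smooth w" and lw: "laplacian w x = 2 * q\<^sup>2 * (exp_vf m z n w x - 1) + vortex_g m z n x" for x
    using w by (auto simp: abelian_higgs_def smooth_H2_def)
  obtain G H where GH: "twice_pd (- z ` {1..m}) (vortex_f m z n) G H"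
    and lap: "\<And>x. x \<notin> z ` {1..m} \<Longrightarrow> H 1 x + H 2 x = - vortex_g m z n x"
    using laplacian_vortex_f[of z m n] by metis
  let ?P = "exp_vf m z n w"
  have cont: "continuous_on UNIV ?P"
    by (rule continuous_exp_vf[OF n smooth_continuous[OF sw]])
  have off: "x \<notin> z ` {1..m}" if "?P x > 1" for x
    using that by (auto simp: exp_vf_def)
  show ?thesis
  proof (rule Keller_Osserman[OF assms(1) cont])
    show "twice_pd {x. ?P x > 1} (\<lambda>x. ln (?P x)) (\<lambda>j x. pd j w x + G j x) (\<lambda>j x. pd j (pd j w) x + H j x)"
    proof (rule twice_pd_cong_open)
      show "twice_pd {x. ?P x > 1} (\<lambda>x. w x + vortex_f m z n x)
          (\<lambda>j x. pd j w x + G j x) (\<lambda>j x. pd j (pd j w) x + H j x)"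
        using off by (intro twice_pd_add smooth_twice_pd sw twice_pd_subset[OF GH]) auto
      show "open {x. ?P x > 1}"
        using cont by (intro open_Collect_less continuous_intros)
      show "w x + vortex_f m z n x = ln (?P x)" if "x \<in> {x. ?P x > 1}" for x
        using off[of x] that by (simp add: exp_vf_def)
    qed
    show "2 * q\<^sup>2 * (?P x - 1) \<le> pd 1 (pd 1 w) x + H 1 x + (pd 2 (pd 2 w) x + H 2 x)" if "?P x > 1" for x
      using lw[of x] lap[OF off[OF that]] by (simp add: laplacian_def sum_2)
  qed
qed

lemma exp_vf_eq_cmod_sq:
  assumes "has_vortices m z n \<phi> v"
  shows "exp_vf m z n v x = (cmod (\<phi> x))\<^sup>2"
proof (cases "x \<in> z ` {1..m}")
  case True
  then have "\<phi> x = 0" using assms unfolding has_vortices_def by blast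
  then show ?thesis using True by (simp add: exp_vf_def)
next
  case False
  then have "\<phi> x \<noteq> 0" "ln ((cmod (\<phi> x))\<^sup>2) = v x + vortex_f m z n x"
    using assms unfolding has_vortices_def by blast+
  then have "exp (v x + vortex_f m z n x) = (cmod (\<phi> x))\<^sup>2"
    by (metis exp_ln zero_less_norm_iff zero_less_power)
  then show ?thesis using False by (simp add: exp_vf_def)
qed

text \<open>\<open>pd_bound\<close> is applied on a square of half-side 1, which fits into the ball
  of radius 3. On this ball the norm drops by at most 3, which costs the factor
  \<open>exp (3 * s)\<close>.\<close>

lemma gradient_decay:
  fixes F :: "real ^ 2 \<Rightarrow> real"
  assumes s: "s > 0" and c: "c > 0"
    and pd: "twice_pd {x. norm x > R} F G H" and cont: "continuous_on {x. norm x > R} F"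
    and F: "\<And>x. norm x > R \<Longrightarrow> \<bar>F x\<bar> \<le> c * exp (- s * norm x)"
    and lap: "\<And>x. norm x > R \<Longrightarrow> \<bar>H 1 x + H 2 x\<bar> \<le> c * exp (- s * norm x)"
    and x: "norm x > R + 3"
  shows "\<bar>G j x\<bar> \<le> 3 * c * exp (3 * s) * exp (- s * norm x)"
proof -
  define M where "M = c * exp (3 * s) * exp (- s * norm x)"
  have M: "M > 0" using c by (simp add: M_def)
  have near: "norm y > R" "c * exp (- s * norm y) \<le> M" if "y \<in> ball x 3" for y
  proof -
    have y: "norm y \<ge> norm x - 3"
      using that norm_triangle_sub[of x y] by (simp add: dist_norm)
    then show "norm y > R" using x by simp
    have "- s * norm y \<le> 3 * s + - s * norm x"
      using mult_left_mono[OF y, of s] s by (simp add: algebra_simps)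
    then have "exp (- s * norm y) \<le> exp (3 * s) * exp (- s * norm x)"
      by (simp add: exp_add[symmetric])
    then show "c * exp (- s * norm y) \<le> M"
      using c unfolding M_def mult.assoc by (intro mult_left_mono) auto
  qed
  \<comment> \<open>The Laplacian bound in \<open>pd_bound\<close> is strict, so it is taken to be
    \<open>2 * M\<close>; the total is \<open>3 * M\<close>.\<close>
  have "\<bar>G j x\<bar> \<le> 2 * M / 1 + 2 * M * 1 / 2"
  proof (rule pd_bound)
    show "y \<in> ball x 3" if "\<And>i. \<bar>y $ i - x $ i\<bar> \<le> 1" for y
      using norm_le_l1_cart[of "y - x"] that[of 1] that[of 2]
      by (simp add: sum_2 dist_norm norm_minus_commute)
    show "twice_pd (ball x 3) F G H" using near by (intro twice_pd_subset[OF pd]) auto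
    show "continuous_on (ball x 3) F" using near by (intro continuous_on_subset[OF cont]) auto
    show "\<bar>F y\<bar> \<le> M" if "y \<in> ball x 3" for y
      using F[OF near(1)[OF that]] near(2)[OF that] by simp
    show "\<bar>H 1 y + H 2 y\<bar> < 2 * M" if "y \<in> ball x 3" for y
      using lap[OF near(1)[OF that]] near(2)[OF that] M by simp
  qed auto
  then show ?thesis by (simp add: M_def)
qed

section \<open>Decay of admissible solutions\<close>

lemma nonpos_of_laplacian_pos:
  assumes "smooth F" "(F \<longlongrightarrow> 0) at_infinity" "\<And>x. F x > 0 \<Longrightarrow> laplacian F x > 0"
  shows "F x \<le> 0"
proof (rule max_principle[where F = F and K = UNIV and S = UNIV])
  show "twice_pd UNIV F (\<lambda>j. pd j F) (\<lambda>j. pd j (pd j F))" by (rule smooth_twice_pd[OF assms(1)])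
  show "continuous_on UNIV F" by (rule smooth_continuous[OF assms(1)])
  show "\<exists>R. \<forall>x\<in>UNIV. R < norm x \<longrightarrow> F x < e" if "e > 0" for e
  proof -
    have "\<forall>\<^sub>F x in at_infinity. F x < e" using assms(2) that by (auto simp: order_tendsto_iff)
    then show ?thesis unfolding eventually_at_infinity by (metis less_imp_le)
  qed
  show "0 < pd 1 (pd 1 F) x + pd 2 (pd 2 F) x" if "0 < F x" for x
    using assms(3)[OF that] by (simp add: laplacian_def sum_2)
qed auto

lemma bogomolnyiD:
  assumes "bogomolnyi q \<kappa> \<phi> A N"
  shows "cov_deriv q A 1 \<phi> x + \<i> * cov_deriv q A 2 \<phi> x = 0"
    and "F12 A x = q * (1 - (cmod (\<phi> x))\<^sup>2) - \<kappa> * N x" and "A 0 x = - N x"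
    and "laplacian (A 0) x = \<kappa> * q * (1 - (cmod (\<phi> x))\<^sup>2) + \<kappa>\<^sup>2 * A 0 x + 2 * q\<^sup>2 * (cmod (\<phi> x))\<^sup>2 * A 0 x"
proof -
  have "F12 A x + (q * (cmod (\<phi> x))\<^sup>2 + \<kappa> * N x - q) = 0"
    using assms unfolding bogomolnyi_def by blast
  then show "F12 A x = q * (1 - (cmod (\<phi> x))\<^sup>2) - \<kappa> * N x"
    unfolding right_diff_distrib by linarith
qed (use assms in \<open>unfold bogomolnyi_def, blast+\<close>)

text \<open>Here N = - A_0 >= 0, so the Laplacian - 2 q F_12 of ln |phi|^2 exceeds 2 q^2 (|phi|^2 -
  1) by the nonnegative term 2 q \<kappa> N.\<close>

lemma cmod_sq_le_1_of_nonpos: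
  assumes q: "q > 0" and k: "\<kappa> > 0" and s: "smooth_fields \<phi> A N" and b: "bogomolnyi q \<kappa> \<phi> A N"
    and A0: "\<And>x. A 0 x \<le> 0"
  shows "(cmod (\<phi> x))\<^sup>2 \<le> 1"
proof -
  have sm: "smooth \<phi>" "smooth (A 1)" "smooth (A 2)"
    using s by (auto simp: smooth_fields_def)
  note sd = bogomolnyiD(1)[OF b] and F = bogomolnyiD(2)[OF b] and N = bogomolnyiD(3)[OF b]
  obtain H where H: "twice_pd {x. \<phi> x \<noteq> 0} (\<lambda>x. ln ((cmod (\<phi> x))\<^sup>2)) (log_pd q A \<phi>) H"
    "\<And>x. \<phi> x \<noteq> 0 \<Longrightarrow> H 1 x + H 2 x = - 2 * q * F12 A x"
    using laplacian_ln_self_dual[OF sm sd] by blast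
  show ?thesis
  proof (rule Keller_Osserman[OF q])
    show "continuous_on UNIV (\<lambda>x. (cmod (\<phi> x))\<^sup>2)"
      by (intro continuous_intros smooth_continuous sm)
    show "twice_pd {x. (cmod (\<phi> x))\<^sup>2 > 1} (\<lambda>x. ln ((cmod (\<phi> x))\<^sup>2)) (log_pd q A \<phi>) H"
      by (rule twice_pd_subset[OF H(1)]) auto
    show "2 * q\<^sup>2 * ((cmod (\<phi> x))\<^sup>2 - 1) \<le> H 1 x + H 2 x" if "(cmod (\<phi> x))\<^sup>2 > 1" for x
    proof -
      have "\<phi> x \<noteq> 0" using that by auto
      from H(2)[OF this] have "H 1 x + H 2 x = 2 * q\<^sup>2 * ((cmod (\<phi> x))\<^sup>2 - 1) + 2 * q * (\<kappa> * N x)"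
        unfolding F by (simp add: algebra_simps power2_eq_square)
      moreover have "2 * q * (\<kappa> * N x) \<ge> 0" using q k A0[of x] N[of x] by simp
      ultimately show ?thesis by linarith
    qed
  qed
qed

text \<open>The third alternative is reduced to the first by the maximum principle, the fourth
  compares with the Abelian Higgs solution, and the second is the claim itself read off the
  vortices.\<close>

lemma admissible_imp_cmod_sq_le_1:
  assumes q: "q > 0" and k: "\<kappa> > 0" and s: "smooth_fields \<phi> A N" and b: "bogomolnyi q \<kappa> \<phi> A N"
    and vo: "has_vortices m z n \<phi> v" and top: "topological \<phi> N" and ad: "admissible q \<kappa> m z n v (A 0)"
  shows "(cmod (\<phi> x))\<^sup>2 \<le> 1"
proof -
  note P = exp_vf_eq_cmod_sq[OF vo]
  note lap = bogomolnyiD(4)[OF b]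
  have N: "A 0 = (\<lambda>x. - N x)" using bogomolnyiD(3)[OF b] by blast
  have lim: "(A 0 \<longlongrightarrow> 0) at_infinity"
    using top tendsto_minus[of N 0] unfolding topological_def N by simp
  have sA: "smooth (A 0)" using s by (simp add: smooth_fields_def)
  note nonpos = cmod_sq_le_1_of_nonpos[OF q k s b]
  have np: "n j > 0" if "j \<in> {1..m}" for j using vo that by (auto simp: has_vortices_def)
  from ad show ?thesis
    unfolding admissible_def
  proof (elim disjE exE conjE)
    assume "\<forall>x. A 0 x \<le> 0"
    then show ?thesis by (intro nonpos) auto
  next
    assume "\<forall>x. x \<notin> z ` {1..m} \<longrightarrow> v x \<le> - vortex_f m z n x"
    then have "exp_vf m z n v x \<le> 1" unfolding exp_vf_def by (auto simp: le_minus_iff algebra_simps)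
    then show ?thesis using P by simp
  next
    assume *: "\<forall>x. A 0 x \<ge> q / \<kappa> * (exp_vf m z n v x - 1)"
    have "A 0 y \<le> 0" for y
    proof (rule nonpos_of_laplacian_pos[OF sA lim])
      fix y assume y: "A 0 y > 0"
      define p where "p = (cmod (\<phi> y))\<^sup>2"
      have "q / \<kappa> * (p - 1) \<le> A 0 y" using * P by (simp add: p_def)
      then have le: "\<kappa>\<^sup>2 * (q / \<kappa> * (p - 1)) \<le> \<kappa>\<^sup>2 * A 0 y" by (intro mult_left_mono) auto
      then have 1: "\<kappa> * q * (1 - p) + \<kappa>\<^sup>2 * A 0 y \<ge> 0"
      proof -
        have "\<kappa>\<^sup>2 * (q / \<kappa> * (p - 1)) = \<kappa> * q * (p - 1)" using k by (simp add: power2_eq_square)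
        with le show ?thesis by (simp add: algebra_simps)
      qed
      show "laplacian (A 0) y > 0"
      \<comment> \<open>The inequality just obtained is not strict. Strictness comes from the term 2
        q^2 p A_0, or, at a zero of phi, from the first two terms, which are then positive.\<close>
      proof (cases "p = 0")
        case True
        have "\<kappa> * q > 0" "\<kappa>\<^sup>2 * A 0 y > 0" using q k y by simp_all
        with True show ?thesis unfolding lap p_def[symmetric] by simp
      next
        case False
        then have "2 * q\<^sup>2 * p * A 0 y > 0" using q y by (simp add: p_def)
        with 1 show ?thesis unfolding lap p_def[symmetric] by linarith
      qed
    qed
    then show ?thesis by (intro nonpos) auto
  next
    fix w assume w: "abelian_higgs q m z n w" "\<forall>x. v x \<le> w x"
    have "exp_vf m z n v x \<le> exp_vf m z n w x" using w(2) by (simp add: exp_vf_def)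
    also have "\<dots> \<le> 1" by (rule abelian_higgs_exp_vf_le_1[OF q np w(1)])
    finally show ?thesis using P by simp
  qed
qed

text \<open>The weights 1 and \<open>2 * \<gamma> / \<rho>\<close> form the positive left eigenvector of the linearised system for
  its smaller eigenvalue \<open>2 * q\<^sup>2 * (1 - \<gamma>)\<close>; the nonlinear error costs at most half of it.\<close>

lemma eigenvector_inequality:
  fixes q \<kappa> g p N :: real
  assumes q: "q > 0" and k: "\<kappa> > 0" and g: "0 < g" "g < 1"
    and quad: "2 * g\<^sup>2 + (\<kappa> / q)\<^sup>2 * g = (\<kappa> / q)\<^sup>2"
    and p: "p \<le> 1" "p \<ge> (1 + g) / 2" and N: "N \<ge> 0"
  defines "b \<equiv> 2 * g * q / \<kappa>"
  shows "2 * q * (q * (1 - p) - \<kappa> * N) + b * (- \<kappa> * q * (1 - p) + \<kappa>\<^sup>2 * N + 2 * q\<^sup>2 * p * N)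
     \<ge> q\<^sup>2 * (1 - g) * (- ln p + b * N)"
proof -
  have b: "b > 0" and bk: "b * \<kappa> = 2 * g * q" using q k g by (auto simp: b_def)
  have "2 * g\<^sup>2 * q\<^sup>2 + \<kappa>\<^sup>2 * g = \<kappa>\<^sup>2"
    using quad q by (simp add: power_divide field_simps)
  then have "\<kappa> * (b * g * q + g * \<kappa>) = \<kappa> * \<kappa>"
    using bk by algebra
  \<comment> \<open>\<open>bk\<close> and \<open>bg\<close> are the two components of the left
    eigenvector equation for the weights 1 and \<open>b\<close>, with common factors
    removed.\<close>
  then have bg: "b * g * q + g * \<kappa> = \<kappa>" using k by simp
  have "2 * q * (q * (1 - p) - \<kappa> * N) + b * (- \<kappa> * q * (1 - p) + \<kappa>\<^sup>2 * N + 2 * q\<^sup>2 * p * N)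
      = 2 * q\<^sup>2 * (1 - g) * (1 - p) + b * N * (2 * q\<^sup>2 * (1 - g)) - 2 * q\<^sup>2 * (1 - p) * (b * N)"
    using bk bg by algebra
  \<comment> \<open>The two losses fall on different components. For N the bound on \<open>p\<close>
    says 2 (1 - p) <= 1 - g, half the eigenvalue up to q^2; for the other, passing from 1 - p to -
    ln p costs a factor of at most 2, since p >= 1/2.\<close>
  moreover have "2 * q\<^sup>2 * (1 - p) * (b * N) \<le> q\<^sup>2 * (1 - g) * (b * N)"
  proof (rule mult_right_mono)
    have "q\<^sup>2 * (2 * (1 - p)) \<le> q\<^sup>2 * (1 - g)" using p by (intro mult_left_mono) auto
    then show "2 * q\<^sup>2 * (1 - p) \<le> q\<^sup>2 * (1 - g)" by (simp only: mult.assoc mult.left_commute)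
    show "0 \<le> b * N" using b N by simp
  qed
  moreover have "q\<^sup>2 * (1 - g) * (- ln p) \<le> q\<^sup>2 * (1 - g) * (2 * (1 - p))"
  proof (rule mult_left_mono)
    have p0: "p \<ge> 1 / 2" using p g by simp
    have "ln (1 / p) \<le> 1 / p - 1" using p0 by (intro ln_le_minus_one) simp
    also have "\<dots> \<le> 2 * (1 - p)"
    proof -
      have "(1 - p) * (1 - 2 * p) \<le> 0" using p(1) p0 by (intro mult_nonneg_nonpos) auto
      then show ?thesis using p0 by (simp add: field_simps power2_eq_square)
    qed
    finally show "- ln p \<le> 2 * (1 - p)" using p0 by (simp add: ln_div)
    show "0 \<le> q\<^sup>2 * (1 - g)" using g by simp
  qed
  ultimately show ?thesis by (simp add: algebra_simps)
qed

lemma exponential_decay_fields: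
  assumes q: "q > 0" and k: "\<kappa> > 0" and s: "smooth_fields \<phi> A N" and bo: "bogomolnyi q \<kappa> \<phi> A N"
    and top: "topological \<phi> N" and P1: "\<And>x. (cmod (\<phi> x))\<^sup>2 \<le> 1"
    and g: "0 < g" "g < 1" and quad: "2 * g\<^sup>2 + (\<kappa> / q)\<^sup>2 * g = (\<kappa> / q)\<^sup>2"
  obtains C R where "C > 0" "R > 0"
    "\<And>x. norm x > R \<Longrightarrow> \<phi> x \<noteq> 0"
    "\<And>x. norm x > R \<Longrightarrow> \<bar>ln ((cmod (\<phi> x))\<^sup>2)\<bar> \<le> C * exp (- (q * sqrt (1 - g)) * norm x)"
    "\<And>x. norm x > R \<Longrightarrow> \<bar>N x\<bar> \<le> C * exp (- (q * sqrt (1 - g)) * norm x)"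
proof -
  define \<sigma> where "\<sigma> = q * sqrt (1 - g)"
  have \<sigma>: "\<sigma> > 0" "\<sigma>\<^sup>2 = q\<^sup>2 * (1 - g)" using q g by (auto simp: \<sigma>_def power_mult_distrib)
  let ?P = "\<lambda>x. (cmod (\<phi> x))\<^sup>2"
  have sm: "smooth \<phi>" "smooth (A 1)" "smooth (A 2)" "smooth (A 0)" "smooth N"
    using s by (auto simp: smooth_fields_def)
  note sd = bogomolnyiD(1)[OF bo] and F = bogomolnyiD(2)[OF bo] and N = bogomolnyiD(3)[OF bo]
    and lap = bogomolnyiD(4)[OF bo]
  have N0: "N x \<ge> 0" for x
  proof -
    have "A 0 x \<le> 0"
    proof (rule nonpos_of_laplacian_pos[OF sm(4)])
      have "A 0 = (\<lambda>x. - N x)" using N by auto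
      then show "(A 0 \<longlongrightarrow> 0) at_infinity"
        using top tendsto_minus[of N 0] by (simp add: topological_def)
      fix x assume x: "A 0 x > 0"
      have "\<kappa>\<^sup>2 * A 0 x > 0" "\<kappa> * q * (1 - ?P x) \<ge> 0" "2 * q\<^sup>2 * ?P x * A 0 x \<ge> 0"
        using x k q P1[of x] by simp_all
      then show "laplacian (A 0) x > 0" unfolding lap by linarith
    qed
    then show ?thesis using N[of x] by simp
  qed
  define b where "b = 2 * g * q / \<kappa>"
  have b: "b > 0" using g q k by (simp add: b_def)
  obtain H where H: "twice_pd {x. \<phi> x \<noteq> 0} (\<lambda>x. ln (?P x)) (log_pd q A \<phi>) H"
    "\<And>x. \<phi> x \<noteq> 0 \<Longrightarrow> H 1 x + H 2 x = - 2 * q * F12 A x"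
    using laplacian_ln_self_dual[OF sm(1-3) sd] by blast
  have "\<forall>\<^sub>F x in at_infinity. ?P x > (1 + g) / 2"
    using top g order_tendstoD(1)[of ?P 1 at_infinity "(1 + g) / 2"] unfolding topological_def by simp
  then obtain R0 where R0: "\<And>x. norm x \<ge> R0 \<Longrightarrow> ?P x > (1 + g) / 2"
    unfolding eventually_at_infinity by blast
  \<comment> \<open>Beyond \<open>R\<close> the modulus is bounded below, so phi has no zeros there
    and \<open>eigenvector_inequality\<close> applies.\<close>
  define R where "R = max R0 1"
  have R: "R > 0" "\<And>x. norm x \<ge> R \<Longrightarrow> ?P x > (1 + g) / 2" using R0 by (auto simp: R_def)
  have nz: "\<phi> x \<noteq> 0" if "norm x \<ge> R" for x using R(2)[OF that] g by auto
  \<comment> \<open>Written through \<open>A 0\<close>, whose Laplacian is the one given, and as a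
    sum of multiples, the shape produced by \<open>twice_pd_add\<close> and
    \<open>twice_pd_cmult\<close>.\<close>
  define W where "W = (\<lambda>x. (- 1) * ln (?P x) + (- b) * A 0 x)"
  have W: "W x = - ln (?P x) + b * N x" for x by (simp add: W_def N)
  have sumW: "(- 1) * H 1 x + (- b) * pd 1 (pd 1 (A 0)) x + ((- 1) * H 2 x + (- b) * pd 2 (pd 2 (A 0)) x) \<ge> \<sigma>\<^sup>2 * W x"
    if x: "norm x > R" for x
  proof -
    have lapA: "pd 1 (pd 1 (A 0)) x + pd 2 (pd 2 (A 0)) x
        = \<kappa> * q * (1 - ?P x) - \<kappa>\<^sup>2 * N x - 2 * q\<^sup>2 * ?P x * N x"
      using lap[of x] by (simp add: laplacian_def sum_2 N)
    have lapu: "H 1 x + H 2 x = - 2 * q * (q * (1 - ?P x) - \<kappa> * N x)"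
      using H(2)[OF nz] x F by simp
    have "(- 1) * H 1 x + (- b) * pd 1 (pd 1 (A 0)) x + ((- 1) * H 2 x + (- b) * pd 2 (pd 2 (A 0)) x)
        = - (H 1 x + H 2 x) - b * (pd 1 (pd 1 (A 0)) x + pd 2 (pd 2 (A 0)) x)"
      by (simp add: algebra_simps)
    also have "\<dots> = 2 * q * (q * (1 - ?P x) - \<kappa> * N x)
        + b * (- \<kappa> * q * (1 - ?P x) + \<kappa>\<^sup>2 * N x + 2 * q\<^sup>2 * ?P x * N x)"
      unfolding lapA lapu by (simp add: algebra_simps)
    also have "\<dots> \<ge> q\<^sup>2 * (1 - g) * (- ln (?P x) + b * N x)"
      unfolding b_def using R(2)[of x] x
      by (intro eigenvector_inequality q k g quad P1 N0) simp
    finally show ?thesis unfolding W \<sigma>(2) .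
  qed
  obtain C where C: "C > 0" "\<And>x. norm x \<ge> R \<Longrightarrow> W x \<le> C * exp (- \<sigma> * norm x)"
  proof (rule exponential_decay[OF R(1) \<sigma>(1)])
    show "twice_pd {x. norm x > R} W (\<lambda>j x. (- 1) * log_pd q A \<phi> j x + (- b) * pd j (A 0) x)
        (\<lambda>j x. (- 1) * H j x + (- b) * pd j (pd j (A 0)) x)"
      unfolding W_def using nz
      by (intro twice_pd_add twice_pd_cmult smooth_twice_pd sm twice_pd_subset[OF H(1)]) auto
    show "continuous_on {x. norm x \<ge> R} W"
      unfolding W_def using nz
      by (intro continuous_intros continuous_on_subset[OF smooth_continuous] sm) auto
    have "(W \<longlongrightarrow> - ln 1 + b * 0) at_infinity"
      unfolding W[abs_def] using top unfolding topological_def by (intro tendsto_intros) auto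
    then show "(W \<longlongrightarrow> 0) at_infinity" by simp
  qed (use sumW in auto)
  define C' where "C' = C + C / b"
  have C': "C \<le> C'" "C / b \<le> C'" "C' > 0" using C(1) b by (auto simp: C'_def add_pos_pos)
  have dec: "- ln (?P x) \<le> C * exp (- \<sigma> * norm x)" "- ln (?P x) \<ge> 0" "N x \<le> C / b * exp (- \<sigma> * norm x)"
    if "norm x > R" for x
  proof -
    have l: "- ln (?P x) \<ge> 0" using nz[of x] that P1[of x] by simp
    have bN: "b * N x \<ge> 0" using b N0 by simp
    have "- ln (?P x) + b * N x \<le> C * exp (- \<sigma> * norm x)" using C(2)[of x] that W by simp
    then show "- ln (?P x) \<le> C * exp (- \<sigma> * norm x)" "N x \<le> C / b * exp (- \<sigma> * norm x)"
      using l bN b by (auto simp: field_simps)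
    show "- ln (?P x) \<ge> 0" by fact
  qed
  show ?thesis
  proof (rule that[OF C'(3) R(1)], unfold \<sigma>_def[symmetric])
    fix x :: "real ^ 2" assume x: "norm x > R"
    show "\<phi> x \<noteq> 0" using nz x by simp
    have "C * exp (- \<sigma> * norm x) \<le> C' * exp (- \<sigma> * norm x)" "C / b * exp (- \<sigma> * norm x) \<le> C' * exp (- \<sigma> * norm x)"
      by (rule mult_right_mono[OF C'(1)], simp, rule mult_right_mono[OF C'(2)], simp)
    then show "\<bar>ln (?P x)\<bar> \<le> C' * exp (- \<sigma> * norm x)" "\<bar>N x\<bar> \<le> C' * exp (- \<sigma> * norm x)"
      using dec[OF x] N0[of x] by linarith+
  qed
qed

text \<open>\<gamma> is the positive root of the quadratic that makes the weights an eigenvector; it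
  is positive because sqrt (\<rho>^2 + 8) exceeds \<rho>.\<close>

lemma gamma_equation:
  fixes \<rho> :: real
  assumes "\<rho> > 0" and g: "\<gamma> = (- \<rho>\<^sup>2 + \<rho> * sqrt (\<rho>\<^sup>2 + 8)) / 4"
  shows "\<gamma> > 0" "2 * \<gamma>\<^sup>2 + \<rho>\<^sup>2 * \<gamma> = \<rho>\<^sup>2"
proof -
  define r where "r = sqrt (\<rho>\<^sup>2 + 8)"
  have r: "r\<^sup>2 = \<rho>\<^sup>2 + 8" by (simp add: r_def)
  have "\<rho> < r" unfolding r_def using assms(1) by (intro real_less_rsqrt) simp
  then have "\<rho> * \<rho> < \<rho> * r" using assms(1) by simp
  then show "\<gamma> > 0" using g by (simp add: r_def power2_eq_square)
  have "4 * \<gamma> = - \<rho>\<^sup>2 + \<rho> * r" using g by (simp add: r_def)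
  with r show "2 * \<gamma>\<^sup>2 + \<rho>\<^sup>2 * \<gamma> = \<rho>\<^sup>2" by algebra
qed

theorem theorem3:
  fixes q \<kappa> \<rho> \<gamma> :: real
    and \<phi> :: "real ^ 2 \<Rightarrow> complex"
    and A :: "nat \<Rightarrow> real ^ 2 \<Rightarrow> real"
    and N v :: "real ^ 2 \<Rightarrow> real"
    and m :: nat and z :: "nat \<Rightarrow> real ^ 2" and n :: "nat \<Rightarrow> nat"
  assumes "q > 0" and "\<kappa> > 0"
    and "smooth_fields \<phi> A N"
    and "has_vortices m z n \<phi> v"
    and "bogomolnyi q \<kappa> \<phi> A N"
    and "topological \<phi> N"
    and "admissible q \<kappa> m z n v (A 0)"
    and "\<rho> = \<kappa> / q"
    and "\<gamma> = (- \<rho>\<^sup>2 + \<rho> * sqrt (\<rho>\<^sup>2 + 8)) / 4"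
  shows "\<forall>\<epsilon>. 0 < \<epsilon> \<and> \<epsilon> < 1 - \<gamma> \<longrightarrow>
    (\<exists>r0 > 0. \<exists>C > 0. \<forall>x. norm x > r0 \<longrightarrow>
       0 \<le> 1 - (cmod (\<phi> x))\<^sup>2 \<and>
       1 - (cmod (\<phi> x))\<^sup>2 \<le> C * exp (- q * sqrt (1 - \<gamma> - \<epsilon>) * norm x) \<and>
       \<bar>N x\<bar> \<le> C * exp (- q * sqrt (1 - \<gamma> - \<epsilon>) * norm x) \<and>
       \<bar>F12 A x\<bar> \<le> C * exp (- q * sqrt (1 - \<gamma> - \<epsilon>) * norm x) \<and>
       (\<forall>\<mu>\<in>{0, 1, 2}. cmod (cov_deriv q A \<mu> \<phi> x) \<le> C * exp (- q * sqrt (1 - \<gamma> - \<epsilon>) * norm x)) \<and>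
       norm (grad (A 0) x) \<le> C * exp (- q * sqrt (1 - \<gamma> - \<epsilon>) * norm x))"
proof (intro allI impI)
  fix \<epsilon> :: real assume \<epsilon>: "0 < \<epsilon> \<and> \<epsilon> < 1 - \<gamma>"
  note q = assms(1) and k = assms(2)
  have "\<rho> > 0" using q k assms(8) by simp
  note g = gamma_equation[OF this assms(9)]
  have g1: "\<gamma> < 1" using \<epsilon> by simp
  let ?P = "\<lambda>x. (cmod (\<phi> x))\<^sup>2"
  have P1: "?P x \<le> 1" for x
    by (rule admissible_imp_cmod_sq_le_1[OF assms(1-3) assms(5,4,6,7)])
  have sm: "smooth \<phi>" "smooth (A 1)" "smooth (A 2)" "smooth (A 0)"
    using assms(3) by (auto simp: smooth_fields_def)
  note sd = bogomolnyiD(1)[OF assms(5)] and F = bogomolnyiD(2)[OF assms(5)]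
    and N = bogomolnyiD(3)[OF assms(5)] and lap = bogomolnyiD(4)[OF assms(5)]
  define \<sigma> where "\<sigma> = q * sqrt (1 - \<gamma>)"
  have \<sigma>: "\<sigma> > 0" using q g1 by (simp add: \<sigma>_def)
  obtain C R where C: "C > 0" and R: "R > 0" and nz: "\<And>x. norm x > R \<Longrightarrow> \<phi> x \<noteq> 0"
    and lnP: "\<And>x. norm x > R \<Longrightarrow> \<bar>ln (?P x)\<bar> \<le> C * exp (- \<sigma> * norm x)"
    and decN: "\<And>x. norm x > R \<Longrightarrow> \<bar>N x\<bar> \<le> C * exp (- \<sigma> * norm x)"
    unfolding \<sigma>_def
    using exponential_decay_fields[OF assms(1-3,5,6) P1 g(1) g1 g(2)[unfolded assms(8)]] by blast
  obtain H where H: "twice_pd {x. \<phi> x \<noteq> 0} (\<lambda>x. ln (?P x)) (log_pd q A \<phi>) H"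
    "\<And>x. \<phi> x \<noteq> 0 \<Longrightarrow> H 1 x + H 2 x = - 2 * q * F12 A x"
    using laplacian_ln_self_dual[OF sm(1-3) sd] by blast
  have decP: "1 - ?P x \<le> C * exp (- \<sigma> * norm x)" if "norm x > R" for x
    using ln_le_minus_one[of "?P x"] nz[OF that] lnP[OF that] by simp
  have decF: "\<bar>F12 A x\<bar> \<le> (q + \<kappa>) * C * exp (- \<sigma> * norm x)" if "norm x > R" for x
  proof -
    have "\<bar>F12 A x\<bar> \<le> q * (1 - ?P x) + \<kappa> * \<bar>N x\<bar>"
      unfolding F using P1[of x] q k by (intro order.trans[OF abs_triangle_ineq4]) (use q in \<open>simp add: abs_mult\<close>)
    also have "\<dots> \<le> q * (C * exp (- \<sigma> * norm x)) + \<kappa> * (C * exp (- \<sigma> * norm x))"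
      using decP[OF that] decN[OF that] q k by (intro add_mono mult_left_mono) auto
    finally show ?thesis by (simp add: algebra_simps)
  qed
  have decL: "\<bar>laplacian (A 0) x\<bar> \<le> (\<kappa> * q + \<kappa>\<^sup>2 + 2 * q\<^sup>2) * C * exp (- \<sigma> * norm x)" if "norm x > R" for x
  proof -
    have "\<bar>laplacian (A 0) x\<bar> \<le> \<kappa> * q * (1 - ?P x) + \<kappa>\<^sup>2 * \<bar>N x\<bar> + 2 * q\<^sup>2 * ?P x * \<bar>N x\<bar>"
      unfolding lap N using P1[of x] q k
      by (intro order.trans[OF abs_triangle_ineq] add_mono) (simp_all add: abs_mult)
    also have "\<dots> \<le> \<kappa> * q * (1 - ?P x) + \<kappa>\<^sup>2 * \<bar>N x\<bar> + 2 * q\<^sup>2 * 1 * \<bar>N x\<bar>"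
      using P1[of x] q by (intro add_mono mult_right_mono mult_left_mono) auto
    also have "\<dots> \<le> \<kappa> * q * (C * exp (- \<sigma> * norm x)) + \<kappa>\<^sup>2 * (C * exp (- \<sigma> * norm x)) + 2 * q\<^sup>2 * 1 * (C * exp (- \<sigma> * norm x))"
      using decP[OF that] decN[OF that] q k by (intro add_mono mult_left_mono) auto
    finally show ?thesis by (simp add: algebra_simps)
  qed
  \<comment> \<open>The sum of all coefficients that occur, so that one constant serves: 1 for the
    fields, q for D_0 phi, then those for the Laplacian of ln |phi|^2, for F_12 and for the
    Laplacian of A_0.\<close>
  define c where "c = (1 + q + 2 * q * (q + \<kappa>) + (q + \<kappa>) + (\<kappa> * q + \<kappa>\<^sup>2 + 2 * q\<^sup>2)) * C"
  have ge: "a * C * exp (- \<sigma> * norm x) \<le> c * exp (- \<sigma> * norm x)"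
    if "a \<le> 1 + q + 2 * q * (q + \<kappa>) + (q + \<kappa>) + (\<kappa> * q + \<kappa>\<^sup>2 + 2 * q\<^sup>2)" for a x
    unfolding c_def using that C by (intro mult_right_mono) auto
  have pos: "0 \<le> 2 * q * (q + \<kappa>)" "0 \<le> \<kappa> * q" "0 \<le> \<kappa>\<^sup>2" "0 \<le> 2 * q\<^sup>2" using q k by auto
  have ge1: "C * exp (- \<sigma> * norm x) \<le> c * exp (- \<sigma> * norm x)" for x
  proof -
    have "1 * C * exp (- \<sigma> * norm x) \<le> c * exp (- \<sigma> * norm x)"
      by (rule ge) (use pos q k in linarith)
    then show ?thesis by (simp only: mult_1)
  qed
  have c: "c > 0" unfolding c_def using C q k pos by (intro mult_pos_pos) linarith+
  have gradu: "\<bar>log_pd q A \<phi> j x\<bar> \<le> 3 * c * exp (3 * \<sigma>) * exp (- \<sigma> * norm x)" if "norm x > R + 3" for j x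
  proof (rule gradient_decay[OF \<sigma> c _ _ _ _ that])
    show "twice_pd {x. norm x > R} (\<lambda>x. ln (?P x)) (log_pd q A \<phi>) H"
      using nz by (intro twice_pd_subset[OF H(1)]) auto
    show "continuous_on {x. norm x > R} (\<lambda>x. ln (?P x))"
      using nz by (intro continuous_intros continuous_on_subset[OF smooth_continuous[OF sm(1)]]) auto
    fix x :: "real ^ 2" assume x: "norm x > R"
    show "\<bar>ln (?P x)\<bar> \<le> c * exp (- \<sigma> * norm x)"
      using lnP[OF x] ge1[of x] by linarith
    have "\<bar>H 1 x + H 2 x\<bar> = 2 * q * \<bar>F12 A x\<bar>"
      using H(2)[OF nz[OF x]] q by (simp add: abs_mult)
    also have "\<dots> \<le> 2 * q * ((q + \<kappa>) * C * exp (- \<sigma> * norm x))"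
      using decF[OF x] q by (intro mult_left_mono) auto
    also have "\<dots> \<le> c * exp (- \<sigma> * norm x)"
      using ge[of "2 * q * (q + \<kappa>)" x] pos q k by (simp add: mult.assoc)
    finally show "\<bar>H 1 x + H 2 x\<bar> \<le> c * exp (- \<sigma> * norm x)" .
  qed
  have gradA: "\<bar>pd j (A 0) x\<bar> \<le> 3 * c * exp (3 * \<sigma>) * exp (- \<sigma> * norm x)" if "norm x > R + 3" for j x
  proof (rule gradient_decay[OF \<sigma> c _ _ _ _ that])
    show "twice_pd {x. norm x > R} (A 0) (\<lambda>j. pd j (A 0)) (\<lambda>j. pd j (pd j (A 0)))"
      by (rule smooth_twice_pd[OF sm(4)])
    show "continuous_on {x. norm x > R} (A 0)"
      by (rule continuous_on_subset[OF smooth_continuous[OF sm(4)]]) simp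
    fix x :: "real ^ 2" assume x: "norm x > R"
    show "\<bar>A 0 x\<bar> \<le> c * exp (- \<sigma> * norm x)"
      using decN[OF x] ge1[of x] by (simp only: N abs_minus_cancel)
    show "\<bar>pd 1 (pd 1 (A 0)) x + pd 2 (pd 2 (A 0)) x\<bar> \<le> c * exp (- \<sigma> * norm x)"
    proof -
      have "\<bar>laplacian (A 0) x\<bar> \<le> c * exp (- \<sigma> * norm x)"
        by (rule order.trans[OF decL[OF x] ge]) (use pos q k in linarith)
      then show ?thesis by (simp only: laplacian_def sum_2)
    qed
  qed
  \<comment> \<open>\<open>c\<close> covers the pointwise bounds; the other summand covers two
    gradient components of \<open>3 * c * exp (3 * \<sigma>)\<close> each.\<close>
  define B where "B = c + 6 * c * exp (3 * \<sigma>)"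
  have B: "B > 0" using c by (simp add: B_def add_pos_pos)
  let ?E = "\<lambda>x :: real ^ 2. exp (- q * sqrt (1 - \<gamma> - \<epsilon>) * norm x)"
  \<comment> \<open>The rate \<sigma> reached so far does not depend on \<epsilon>; subtracting
    \<epsilon> under the root only slows the exponential down.\<close>
  have E: "t \<le> B * ?E x" if "t \<le> a * exp (- \<sigma> * norm x)" "a \<le> B" for t a x
  proof -
    have "q * sqrt (1 - \<gamma> - \<epsilon>) * norm x \<le> \<sigma> * norm x"
      unfolding \<sigma>_def using \<epsilon> q by (intro mult_right_mono mult_left_mono) auto
    then have "exp (- \<sigma> * norm x) \<le> ?E x" by simp
    then have "B * exp (- \<sigma> * norm x) \<le> B * ?E x" using B by (intro mult_left_mono) auto
    moreover have "a * exp (- \<sigma> * norm x) \<le> B * exp (- \<sigma> * norm x)" using that(2) by (intro mult_right_mono) auto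
    ultimately show ?thesis using that(1) by linarith
  qed
  have cB: "c \<le> B" "6 * c * exp (3 * \<sigma>) \<le> B" using c by (auto simp: B_def)
  have "0 \<le> 1 - ?P x \<and> 1 - ?P x \<le> B * ?E x \<and> \<bar>N x\<bar> \<le> B * ?E x \<and> \<bar>F12 A x\<bar> \<le> B * ?E x \<and>
      (\<forall>\<mu>\<in>{0, 1, 2}. cmod (cov_deriv q A \<mu> \<phi> x) \<le> B * ?E x) \<and> norm (grad (A 0) x) \<le> B * ?E x"
    if x3: "norm x > R + 3" for x
  proof -
    have x: "norm x > R" using x3 by simp
    have cm: "cmod (\<phi> x) \<le> 1" using P1[of x] by (simp add: power2_nonneg_ge_1_iff abs_square_le_1)
    have "1 - ?P x \<le> c * exp (- \<sigma> * norm x)" "\<bar>N x\<bar> \<le> c * exp (- \<sigma> * norm x)"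
      using decP[OF x] decN[OF x] ge1[of x] by linarith+
    moreover have "\<bar>F12 A x\<bar> \<le> c * exp (- \<sigma> * norm x)"
      by (rule order.trans[OF decF[OF x] ge]) (use pos q k in linarith)
    moreover have "cmod (cov_deriv q A 0 \<phi> x) \<le> c * exp (- \<sigma> * norm x)"
    proof -
      have "cmod (cov_deriv q A 0 \<phi> x) = q * \<bar>N x\<bar> * cmod (\<phi> x)"
        using q by (simp add: cov_deriv_def spacetime_pd_def norm_mult N)
      also have "\<dots> \<le> q * (C * exp (- \<sigma> * norm x)) * 1"
        using q cm decN[OF x] C by (intro mult_mono mult_left_mono) auto
      also have "\<dots> \<le> c * exp (- \<sigma> * norm x)"
        using ge[of q x] pos q k by (simp add: mult.assoc)
      finally show ?thesis .
    qed
    moreover have "cmod (cov_deriv q A \<mu> \<phi> x) \<le> 6 * c * exp (3 * \<sigma>) * exp (- \<sigma> * norm x)"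
      if "\<mu> = 1 \<or> \<mu> = 2" for \<mu>
      using cov_deriv_bound[OF sm(1) nz[OF x] cm sd that] gradu[OF x3, of 1] gradu[OF x3, of 2] by linarith
    moreover have "norm (grad (A 0) x) \<le> 6 * c * exp (3 * \<sigma>) * exp (- \<sigma> * norm x)"
      using norm_le_l1_cart[of "grad (A 0) x"] gradA[OF x3, of 1] gradA[OF x3, of 2]
      by (simp add: sum_2 grad_def)
    ultimately show ?thesis
      using P1[of x] E[OF _ cB(1)] E[OF _ cB(2)] by auto
  qed
  then show "\<exists>r0>0. \<exists>C>0. \<forall>x. norm x > r0 \<longrightarrow>
      0 \<le> 1 - ?P x \<and> 1 - ?P x \<le> C * ?E x \<and> \<bar>N x\<bar> \<le> C * ?E x \<and> \<bar>F12 A x\<bar> \<le> C * ?E x \<and>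
      (\<forall>\<mu>\<in>{0, 1, 2}. cmod (cov_deriv q A \<mu> \<phi> x) \<le> C * ?E x) \<and> norm (grad (A 0) x) \<le> C * ?E x"
    using B R by (intro exI[of _ "R + 3"] conjI exI[of _ B]) auto
qed

end
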